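(* Let $M$ be a finite median graph. Then $$c(M)\le \left\lceil \frac{\mathrm{tdim}(M)+1}{2}\right\rceil=\left\lceil \frac{\chi(M^{\#})+1}{2}\right\rceil ,$$ where $c(M)$ is the cop number of $M$, $\mathrm{tdim}(M)$ is the tree-dimension of $M$, and $\chi(M^{\#})$ is the chromatic number of the crossing graph $M^{\#}$ of $M$.
   Context: All graphs are finite, simple and undirected, and graphs on which the game is played are connected. Cops and Robbers: on a connected graph $G$, the cops first choose initial vertices (several cops may share a vertex), then the robber chooses an initial vertex. The sides then move alternately, cops first; on the cops' turn every cop, and on the robber's turn the robber, either stays or moves to an adjacent vertex. All positions are visible to all players. The cops win if at some time a cop occupies the robber's vertex; the robber wins if he evades capture forever. The cop number $c(G)$ is the minimum number of cops that guarantees capture. For $u,v\in V(G)$, $d_G(u,v)$ is the shortest-path distance and $I(u,v)$ is the set of vertices on shortest $u,v$-paths. A (connected) graph $M$ is a median graph if for every triple $x,y,z\in V(M)$ there is a unique vertex in $I(x,y)\cap I(x,z)\cap I(y,z)$. A partial cube is a graph admitting an isometric (distance-preserving) embedding into a hypercube $Q_n$; every median graph is a partial cube. The tree-dimension $\mathrm{tdim}(G)$ is the minimum nonnegative integer $t$ such that $G$ admits an isometric embedding into a Cartesian product of $t$ trees. For the one-vertex graph $K_1$ the convention $\mathrm{tdim}(K_1)=1$ is used. Djoković–Winkler relation on $E(G)$: for edges $e=uv$, $f=xy$, $e\,\Theta\,f$ iff $d_G(u,x)+d_G(v,y)\ne d_G(u,y)+d_G(v,x)$. In a partial cube $\Theta$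 is an equivalence relation; its classes are called $\Theta$-classes. For a $\Theta$-class $E$ and $xy\in E$, the two semicubes are $W_E^0=\{a: d_G(x,a)<d_G(y,a)\}$ and $W_E^1=\{a: d_G(y,a)<d_G(x,a)\}$ (independent of the choice of $xy\in E$ up to swapping labels). Two $\Theta$-classes $E,F$ cross if $W_E^\varepsilon\cap W_F^\delta\neq\emptyset$ for all $\varepsilon,\delta\in\{0,1\}$. The crossing graph $G^{\#}$ has the $\Theta$-classes of $G$ as vertices, two being adjacent iff they cross. In particular $K_1^{\#}$ is the empty graph (no vertices), and the chromatic number of the empty graph is $0$. *)

theory Defs
  imports
    "Graph_Theory.Pair_Digraph"
    "Graph_Theory.Digraph_Component"
    "Graph_Theory.Shortest_Path"
begin

text \<open>
  A finite simple undirected graph is a \<^locale>\<open>pair_graph\<close>: a finite, loop-free digraph with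
  a symmetric arc relation, an undirected edge \<open>uv\<close> being the pair of arcs \<open>(u, v)\<close>, \<open>(v, u)\<close>.
  The library notion \<^const>\<open>connected\<close> includes that there is at least one vertex.
\<close>

section \<open>Distance, intervals, median graphs\<close>

definition gdist :: "'a pair_pre_digraph \<Rightarrow> 'a \<Rightarrow> 'a \<Rightarrow> nat" where
  "gdist G u v = (LEAST n. \<exists>p. pre_digraph.awalk (with_proj G) u p v \<and> length p = n)"

text \<open>
  The library's shortest-path value \<open>\<mu>\<close> is \<^typ>\<open>ereal\<close>-valued; with unit weights
  it agrees with \<^const>\<open>gdist\<close> (whose value is arbitrary for unreachable pairs).
\<close>

lemma gdist_eq_mu:
  assumes "wf_digraph (with_proj G)" and "u \<rightarrow>\<^sup>*\<^bsub>with_proj G\<^esub> v"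
  shows "wf_digraph.\<mu> (with_proj G) (\<lambda>_. 1) u v = ereal (real (gdist G u v))"
proof -
  interpret wf_digraph "with_proj G" by fact
  have cost: "awalk_cost (\<lambda>_. 1) p = real (length p)" for p
    by (induction p) simp_all
  let ?P = "\<lambda>n. \<exists>p. awalk u p v \<and> length p = n"
  obtain p0 where "awalk u p0 v"
    using assms(2) reachable_awalk by blast
  then have "?P (length p0)" by blast
  then have "?P (gdist G u v)"
    unfolding gdist_def by (rule LeastI)
  then obtain p where p: "awalk u p v" "length p = gdist G u v" by blast
  have least: "gdist G u v \<le> length q" if "awalk u q v" for q
    unfolding gdist_def by (rule Least_le) (use that in blast)
  show ?thesis
    unfolding \<mu>_def cost
  proof (rule INF_eqI)
    show "ereal (real (gdist G u v)) \<le> ereal (real (length q))" if "q \<in> {p. awalk u p v}" for q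
      using least that by simp
    show "y \<le> ereal (real (gdist G u v))"
      if "\<And>q. q \<in> {p. awalk u p v} \<Longrightarrow> y \<le> ereal (real (length q))" for y
      using that[of p] p by simp
  qed
qed

definition shortest_path :: "'a pair_pre_digraph \<Rightarrow> 'a \<Rightarrow> ('a \<times> 'a) awalk \<Rightarrow> 'a \<Rightarrow> bool" where
  "shortest_path G u p v \<longleftrightarrow> pre_digraph.apath (with_proj G) u p v \<and> length p = gdist G u v"

definition interval :: "'a pair_pre_digraph \<Rightarrow> 'a \<Rightarrow> 'a \<Rightarrow> 'a set" where
  "interval G u v =
    {w. \<exists>p. shortest_path G u p v \<and> w \<in> set (pre_digraph.awalk_verts (with_proj G) u p)}"

definition median_graph :: "'a pair_pre_digraph \<Rightarrow> bool" where
  "median_graph M \<longleftrightarrow> pair_graph M \<and> connected (with_proj M) \<and>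
    (\<forall>x\<in>pverts M. \<forall>y\<in>pverts M. \<forall>z\<in>pverts M.
      \<exists>!m. m \<in> interval M x y \<inter> interval M x z \<inter> interval M y z)"

section \<open>Cops and Robbers\<close>

definition step :: "'a pair_pre_digraph \<Rightarrow> 'a \<Rightarrow> 'a \<Rightarrow> bool" where
  "step G u v \<longleftrightarrow> u \<in> pverts G \<and> v \<in> pverts G \<and> (u = v \<or> (u, v) \<in> parcs G)"

text \<open>
  \<open>r n\<close> is the robber's position after his initial choice (\<open>n = 0\<close>) or his \<open>n\<close>-th move.
\<close>

definition robber_play :: "'a pair_pre_digraph \<Rightarrow> (nat \<Rightarrow> 'a) \<Rightarrow> bool" where
  "robber_play G r \<longleftrightarrow> r 0 \<in> pverts G \<and> (\<forall>n. step G (r n) (r (Suc n)))"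

text \<open>
  A strategy for the cops maps the list of robber positions seen so far to the positions of the
  cops: \<open>\<sigma> []\<close> is the initial placement, and \<open>cop_play \<sigma> r (Suc n)\<close> is the answer
  to \<open>r 0, \<dots>, r n\<close>. The earlier cop positions are determined by \<open>\<sigma>\<close> and this history.
\<close>

definition cop_play :: "('a list \<Rightarrow> 'a list) \<Rightarrow> (nat \<Rightarrow> 'a) \<Rightarrow> nat \<Rightarrow> 'a list" where
  "cop_play \<sigma> r n = \<sigma> (map r [0..<n])"

definition cop_strategy :: "'a pair_pre_digraph \<Rightarrow> nat \<Rightarrow> ('a list \<Rightarrow> 'a list) \<Rightarrow> bool" where
  "cop_strategy G k \<sigma> \<longleftrightarrow>
    length (\<sigma> []) = k \<and> set (\<sigma> []) \<subseteq> pverts G \<and>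
    (\<forall>r. robber_play G r \<longrightarrow> (\<forall>n. list_all2 (step G) (cop_play \<sigma> r n) (cop_play \<sigma> r (Suc n))))"

text \<open>Capture happens after a choice or move of the robber, or after a move of the cops.\<close>

definition captured :: "('a list \<Rightarrow> 'a list) \<Rightarrow> (nat \<Rightarrow> 'a) \<Rightarrow> bool" where
  "captured \<sigma> r \<longleftrightarrow> (\<exists>n. r n \<in> set (cop_play \<sigma> r n) \<or> r n \<in> set (cop_play \<sigma> r (Suc n)))"

definition cops_win :: "'a pair_pre_digraph \<Rightarrow> nat \<Rightarrow> bool" where
  "cops_win G k \<longleftrightarrow> (\<exists>\<sigma>. cop_strategy G k \<sigma> \<and> (\<forall>r. robber_play G r \<longrightarrow> captured \<sigma> r))"

definition cop_number :: "'a pair_pre_digraph \<Rightarrow> nat" where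
  "cop_number G = (LEAST k. cops_win G k)"

section \<open>Tree-dimension\<close>

text \<open>
  In a symmetric digraph the closed walk \<open>u, v, u\<close> counts as a \<open>cycle\<close> of the library (so that
  the library's \<^const>\<open>tree\<close> is not the undirected notion); the cycles of the undirected graph
  are those of length at least 3.
\<close>

definition undirected_tree :: "'a pair_pre_digraph \<Rightarrow> bool" where
  "undirected_tree T \<longleftrightarrow> pair_graph T \<and> connected (with_proj T) \<and>
    \<not> (\<exists>p. pre_digraph.cycle (with_proj T) p \<and> 3 \<le> length p)"

definition cartesian_product :: "'a pair_pre_digraph list \<Rightarrow> 'a list pair_pre_digraph" where
  "cartesian_product Gs =
    (let V = {xs. length xs = length Gs \<and> (\<forall>i<length Gs. xs ! i \<in> pverts (Gs ! i))}
     in \<lparr>pverts = V,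
         parcs = {(xs, ys). xs \<in> V \<and> ys \<in> V \<and>
           (\<exists>i<length Gs. (xs ! i, ys ! i) \<in> parcs (Gs ! i) \<and>
             (\<forall>j<length Gs. j \<noteq> i \<longrightarrow> xs ! j = ys ! j))}\<rparr>)"

definition isometric_embedding ::
    "('a \<Rightarrow> 'b) \<Rightarrow> 'a pair_pre_digraph \<Rightarrow> 'b pair_pre_digraph \<Rightarrow> bool" where
  "isometric_embedding f G H \<longleftrightarrow> f ` pverts G \<subseteq> pverts H \<and>
    (\<forall>u\<in>pverts G. \<forall>v\<in>pverts G. gdist H (f u) (f v) = gdist G u v)"

text \<open>
  The trees are finite, so vertices of type \<^typ>\<open>nat\<close> cover all of them up to isomorphism.
  The first case is the convention for the one-vertex graph, which embeds into the empty product.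
\<close>

definition tdim :: "'a pair_pre_digraph \<Rightarrow> nat" where
  "tdim G = (if card (pverts G) = 1 then 1 else
    (LEAST t. \<exists>(Ts :: nat pair_pre_digraph list) f.
      length Ts = t \<and> (\<forall>T\<in>set Ts. undirected_tree T) \<and>
      isometric_embedding f G (cartesian_product Ts)))"

section \<open>Crossing graph and chromatic number\<close>

definition edges :: "'a pair_pre_digraph \<Rightarrow> 'a set set" where
  "edges G = {{u, v} | u v. (u, v) \<in> parcs G}"

text \<open>
  The inequality is invariant under exchanging \<open>u, v\<close> and under exchanging \<open>x, y\<close>, so the choice
  of the orientations of the two edges does not matter.
\<close>

definition Theta :: "'a pair_pre_digraph \<Rightarrow> 'a set rel" where
  "Theta G = {({u, v}, {x, y}) | u v x y. (u, v) \<in> parcs G \<and> (x, y) \<in> parcs G \<and>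
    gdist G u x + gdist G v y \<noteq> gdist G u y + gdist G v x}"

definition Theta_classes :: "'a pair_pre_digraph \<Rightarrow> 'a set set set" where
  "Theta_classes G = edges G // Theta G"

text \<open>
  Since both orientations of each edge of \<open>E\<close> are used and semicubes do not depend on the edge
  chosen in a class of a partial cube, this is the set of the two semicubes \<open>W\<^sub>E\<^sup>0\<close>, \<open>W\<^sub>E\<^sup>1\<close>.
\<close>

definition semicubes :: "'a pair_pre_digraph \<Rightarrow> 'a set set \<Rightarrow> 'a set set" where
  "semicubes G E = {{a \<in> pverts G. gdist G x a < gdist G y a} | x y.
    (x, y) \<in> parcs G \<and> {x, y} \<in> E}"

definition cross :: "'a pair_pre_digraph \<Rightarrow> 'a set set \<Rightarrow> 'a set set \<Rightarrow> bool" where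
  "cross G E F \<longleftrightarrow> (\<forall>V\<in>semicubes G E. \<forall>W\<in>semicubes G F. V \<inter> W \<noteq> {})"

definition crossing_graph :: "'a pair_pre_digraph \<Rightarrow> 'a set set pair_pre_digraph" where
  "crossing_graph G = \<lparr>pverts = Theta_classes G,
    parcs = {(E, F). E \<in> Theta_classes G \<and> F \<in> Theta_classes G \<and> cross G E F}\<rparr>"

definition proper_colouring :: "'a pair_pre_digraph \<Rightarrow> nat \<Rightarrow> ('a \<Rightarrow> nat) \<Rightarrow> bool" where
  "proper_colouring G k c \<longleftrightarrow>
    (\<forall>v\<in>pverts G. c v < k) \<and> (\<forall>(u, v)\<in>parcs G. c u \<noteq> c v)"

definition chromatic_number :: "'a pair_pre_digraph \<Rightarrow> nat" where
  "chromatic_number G = (LEAST k. \<exists>c. proper_colouring G k c)"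

end

theory Submission
  imports Defs
begin

text \<open>
  A median graph embeds isometrically into the cube whose coordinates are its \<open>\<Theta>\<close>-classes, and
  the image is closed under majority. Hence, by a Helly argument, it is cut out by forbidden patterns
  on pairs of coordinates, and replacing a forbidden pattern by the opposite one is nonexpansive; so
  the image is a retract of the cube. Cops may therefore play virtually in the cube and be retracted.

  Colour the classes so that crossing classes differ. The classes of one colour form a tree, which is
  how colourings and embeddings into products of trees correspond. Each cop but the last is in charge
  of two colours and keeps an even distance to the robber; the last is in charge of one colour. A cop
  answers a retreat of the robber so that the distance does not grow, and so that it comes to be
  positive in the colours of the cop; from then on every retreat in such a colour shrinks the part of
  its tree left to the robber. When the robber passes, the last cop comes closer. With \<open>k\<close> cops and
  at most \<open>2k - 1\<close> colours, every move of the robber decreases a potential.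
\<close>

section \<open>Retraction of a cube onto a median-closed subset\<close>

text \<open>A virtual cop need not stand on a vertex of the graph. His position is a vertex of the
  product of the trees of the colours, where he can approach in every colour in which he differs
  from the robber. The retraction turns his moves into moves of the graph and fixes the graph
  pointwise, so meeting the robber virtually is a capture. The obstacle is a robber who retreats in
  a guarded colour in which no class separated him from the cop. To keep the gap, the cop spends a
  step in another colour, and this must not remove the last separation in his other guarded colour.
  An even positive gap leaves room: its two or more classes include one of an unguarded colour or
  two of the same colour. But parity forbids a cop with two colours to profit from a pass. A cop
  with a single colour needs no parity and can come closer then. So one cop is reserved for passes,
  and \<open>k\<close> cops serve \<open>2 * k - 1\<close> colours rather than \<open>2 * k\<close>;
  the least such \<open>k\<close> is the ceiling in the bound.\<close>

definition delta :: "'i set \<Rightarrow> 'i set \<Rightarrow> 'i set" where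
  "delta x y = (x - y) \<union> (y - x)"

definition flip :: "'i \<Rightarrow> 'i set \<Rightarrow> 'i set" where
  "flip E x = (if E \<in> x then x - {E} else insert E x)"

lemma in_delta [simp]: "E \<in> delta x y \<longleftrightarrow> (E \<in> x) \<noteq> (E \<in> y)"
  by (auto simp: delta_def)

lemma in_flip [simp]: "F \<in> flip E x \<longleftrightarrow> (F \<in> x) \<noteq> (F = E)"
  by (auto simp: flip_def)

lemma finite_delta [simp]: "finite x \<Longrightarrow> finite y \<Longrightarrow> finite (delta x y)"
  by (simp add: delta_def)

lemma flip_subset: "x \<subseteq> I \<Longrightarrow> E \<in> I \<Longrightarrow> flip E x \<subseteq> I"
  by (auto simp: flip_def)

lemma flip_flip [simp]: "flip E (flip E x) = x"
  by (auto simp: set_eq_iff)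

lemma delta_flip_left: "delta (flip E x) y = flip E (delta x y)"
  by (auto simp: set_eq_iff)

lemma delta_flip_right: "delta x (flip E y) = flip E (delta x y)"
  by (auto simp: set_eq_iff)

lemma delta_eq_empty [simp]: "delta x y = {} \<longleftrightarrow> x = y"
  by (auto simp: delta_def)

lemma delta_self [simp]: "delta x x = {}"
  by simp

lemma delta_singleton: "delta x y = {E} \<longleftrightarrow> y = flip E x"
  by (auto simp: set_eq_iff)

lemma card_eq_two_points:
  assumes "finite A" "E \<noteq> F"
  shows "card A = card (A - {E, F}) + of_bool (E \<in> A) + of_bool (F \<in> A)"
proof -
  have "card A = card (A - {E, F}) + card (A \<inter> {E, F})"
    using assms(1) by (metis Int_Diff_disjoint Int_Diff_Un Un_commute card_Un_disjoint finite_Diff finite_Int inf_commute)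
  moreover have "card (A \<inter> {E, F}) = of_bool (E \<in> A) + of_bool (F \<in> A)"
    using assms(2) by (cases "E \<in> A"; cases "F \<in> A") auto
  ultimately show ?thesis by simp
qed

text \<open>Flipping only \<open>E\<close> would not do: a forbidden point and its neighbour across
  \<open>F\<close> would come to lie at distance 2.\<close>

definition gate :: "'i \<Rightarrow> bool \<Rightarrow> 'i \<Rightarrow> bool \<Rightarrow> 'i set \<Rightarrow> 'i set" where
  "gate E e F f x = (if (E \<in> x) = e \<and> (F \<in> x) = f then flip E (flip F x) else x)"

text \<open>Outside \<open>E\<close> and \<open>F\<close> nothing changes. On these two coordinates
  the gate folds one corner of a 4-cycle onto the opposite corner, which increases no
  distance.\<close>

lemma gate_nonexpansive:
  assumes "E \<noteq> F" "finite x" "finite y"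
  shows "card (delta (gate E e F f x) (gate E e F f y)) \<le> card (delta x y)"
proof -
  have fin: "finite (gate E e F f z)" if "finite z" for z
    using that by (auto simp: gate_def flip_def)
  have "delta (gate E e F f x) (gate E e F f y) - {E, F} = delta x y - {E, F}"
    by (auto simp: gate_def)
  then show ?thesis
    using card_eq_two_points[OF finite_delta[OF fin[OF assms(2)] fin[OF assms(3)]] assms(1)]
      card_eq_two_points[OF finite_delta[OF assms(2,3)] assms(1)] assms(1)
    by (auto simp: gate_def)
qed

text \<open>\<open>geodesic\<close> allows walking inside the image towards any target by single
  flips. The last two assumptions exclude constant, equal and complementary coordinates: by them a
  forbidden pattern involves two distinct coordinates, and its opposite occurs.\<close>

locale median_cube =
  fixes V :: "'a set" and I :: "'i set" and h :: "'a \<Rightarrow> 'i set"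
  assumes finite_V: "finite V" and V_nonempty: "V \<noteq> {}" and finite_I: "finite I"
    and h_subset: "a \<in> V \<Longrightarrow> h a \<subseteq> I"
    and geodesic: "a \<in> V \<Longrightarrow> b \<in> V \<Longrightarrow> a \<noteq> b \<Longrightarrow>
      \<exists>a'\<in>V. \<exists>E\<in>delta (h a) (h b). h a' = flip E (h a)"
    and majority: "a \<in> V \<Longrightarrow> b \<in> V \<Longrightarrow> c \<in> V \<Longrightarrow>
      \<exists>m\<in>V. h m = (h a \<inter> h b) \<union> (h a \<inter> h c) \<union> (h b \<inter> h c)"
    and both_sides: "E \<in> I \<Longrightarrow> (\<exists>a\<in>V. E \<in> h a) \<and> (\<exists>a\<in>V. E \<notin> h a)"
    and independent: "E \<in> I \<Longrightarrow> F \<in> I \<Longrightarrow> E \<noteq> F \<Longrightarrow>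
      (\<exists>a\<in>V. (E \<in> h a) = (F \<in> h a)) \<and> (\<exists>a\<in>V. (E \<in> h a) \<noteq> (F \<in> h a))"
begin

lemma h_inj: "a \<in> V \<Longrightarrow> b \<in> V \<Longrightarrow> h a = h b \<Longrightarrow> a = b"
  using geodesic by fastforce

lemma finite_sub: "x \<subseteq> I \<Longrightarrow> finite x"
  using finite_I finite_subset by blast

lemma finite_h [simp]: "a \<in> V \<Longrightarrow> finite (h a)"
  using h_subset finite_sub by blast

text \<open>Dropping each of three coordinates in turn yields three vertices by induction. On every
  coordinate of \<open>J\<close> at most one of them errs, so their majority is right on all of
  \<open>J\<close>. For at most two coordinates the hypothesis on pairs suffices.\<close>

lemma helly:
  assumes pairs: "\<And>E F. E \<in> I \<Longrightarrow> F \<in> I \<Longrightarrow> \<exists>m\<in>V. (E \<in> h m \<longleftrightarrow> E \<in> x) \<and> (F \<in> h m \<longleftrightarrow> F \<in> x)"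
    and "J \<subseteq> I"
  shows "\<exists>m\<in>V. \<forall>E\<in>J. E \<in> h m \<longleftrightarrow> E \<in> x"
proof -
  have "finite J" using assms(2) finite_sub by blast
  then show ?thesis using assms(2)
  proof (induction J rule: finite_psubset_induct)
    case (psubset J)
    consider "card J \<le> 2" | "card J \<ge> 3" by linarith
    then show ?case
    proof cases
      case 1
      then consider "J = {}" | E where "J = {E}" | E F where "J = {E, F}"
        using psubset.hyps by (metis card_0_eq card_1_singletonE card_2_iff le_Suc_eq le_zero_eq numeral_2_eq_2 One_nat_def)
      then show ?thesis
      proof cases
        case 1 then show ?thesis using V_nonempty by auto
      next
        case 2 then show ?thesis using pairs[of E E] psubset.prems by auto
      next
        case 3 then show ?thesis using pairs[of E F] psubset.prems by auto
      qed
    next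
      case 2
      then obtain S where S: "S \<subseteq> J" "card S = 3" by (metis obtain_subset_with_card_n)
      then obtain E1 E2 E3 where E: "S = {E1, E2, E3}" "E1 \<noteq> E2" "E2 \<noteq> E3" "E1 \<noteq> E3"
        by (metis card_3_iff)
      have "\<exists>m\<in>V. \<forall>F\<in>J - {E}. F \<in> h m \<longleftrightarrow> F \<in> x" if "E \<in> J" for E
        using psubset.IH[of "J - {E}"] psubset.prems that by blast
      with S E obtain m1 m2 m3 where m: "m1 \<in> V" "m2 \<in> V" "m3 \<in> V"
        "\<forall>F\<in>J - {E1}. F \<in> h m1 \<longleftrightarrow> F \<in> x" "\<forall>F\<in>J - {E2}. F \<in> h m2 \<longleftrightarrow> F \<in> x"
        "\<forall>F\<in>J - {E3}. F \<in> h m3 \<longleftrightarrow> F \<in> x" by (metis insert_subset)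
      obtain n where n: "n \<in> V" "h n = (h m1 \<inter> h m2) \<union> (h m1 \<inter> h m3) \<union> (h m2 \<inter> h m3)"
        using majority m(1-3) by blast
      have "F \<in> h n \<longleftrightarrow> F \<in> x" if "F \<in> J" for F
        using m(4-6) E(2-4) that unfolding n(2) by blast
      with n(1) show ?thesis by blast
    qed
  qed
qed

text \<open>
  Take a nonexpansive map fixing the image whose values have the least total distance to the image. If one of
  its values had a forbidden pattern, composing with the gate would decrease the total, since the opposite
  pattern does occur in the image.
\<close>

lemma retraction:
  obtains g where "\<And>x. x \<subseteq> I \<Longrightarrow> g x \<in> h ` V"
    and "\<And>x y. x \<subseteq> I \<Longrightarrow> y \<subseteq> I \<Longrightarrow> card (delta (g x) (g y)) \<le> card (delta x y)"
    and "\<And>a. a \<in> V \<Longrightarrow> g (h a) = h a"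
proof -
  define R where "R g \<longleftrightarrow> (\<forall>x. x \<subseteq> I \<longrightarrow> g x \<subseteq> I) \<and>
    (\<forall>x y. x \<subseteq> I \<longrightarrow> y \<subseteq> I \<longrightarrow> card (delta (g x) (g y)) \<le> card (delta x y)) \<and>
    (\<forall>a\<in>V. g (h a) = h a)" for g :: "'i set \<Rightarrow> 'i set"
  define S where "S x = (\<Sum>a\<in>V. card (delta x (h a)))" for x
  have "R id" by (simp add: R_def)
  then obtain g where g: "R g" and least: "\<And>g'. R g' \<Longrightarrow> (\<Sum>x\<in>Pow I. S (g x)) \<le> (\<Sum>x\<in>Pow I. S (g' x))"
    using ex_has_least_nat[of R id "\<lambda>g. \<Sum>x\<in>Pow I. S (g x)"] by blast
  have "g x0 \<in> h ` V" if x0: "x0 \<subseteq> I" for x0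
  proof (rule ccontr)
    assume no: "g x0 \<notin> h ` V"
    have gx0: "g x0 \<subseteq> I" using g x0 by (simp add: R_def)
    have "\<not> (\<exists>m\<in>V. \<forall>E\<in>I. E \<in> h m \<longleftrightarrow> E \<in> g x0)"
      using no gx0 h_subset by blast
    then obtain E F where EF: "E \<in> I" "F \<in> I"
      and forb: "\<And>m. m \<in> V \<Longrightarrow> \<not> ((E \<in> h m \<longleftrightarrow> E \<in> g x0) \<and> (F \<in> h m \<longleftrightarrow> F \<in> g x0))"
      using helly[of "g x0" I] by blast
    have "E \<noteq> F" using forb both_sides[OF EF(1)] by blast
    define e f where "e = (E \<in> g x0)" and "f = (F \<in> g x0)"
    define G where "G = gate E e F f"
    have G_sub: "G x \<subseteq> I" if "x \<subseteq> I" for x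
      using that EF by (simp add: G_def gate_def flip_subset)
    have G_ne: "card (delta (G x) (G y)) \<le> card (delta x y)" if "x \<subseteq> I" "y \<subseteq> I" for x y
      unfolding G_def by (rule gate_nonexpansive[OF \<open>E \<noteq> F\<close> finite_sub[OF that(1)] finite_sub[OF that(2)]])
    have G_fix: "G (h a) = h a" if "a \<in> V" for a
      using forb[OF that] by (auto simp: G_def gate_def e_def f_def)
    have "R (G \<circ> g)"
      using g G_sub G_ne G_fix unfolding R_def o_def by simp (meson order_trans)
    have le: "card (delta (G x) (h a)) \<le> card (delta x (h a))" if "x \<subseteq> I" "a \<in> V" for x a
      using G_ne[OF that(1) h_subset[OF that(2)]] G_fix[OF that(2)] by simp
    obtain b where b: "b \<in> V" "(E \<in> h b) \<noteq> e" "(F \<in> h b) \<noteq> f"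
      using independent[OF EF \<open>E \<noteq> F\<close>] forb unfolding e_def f_def by metis
    have "delta (G (g x0)) (h b) \<subset> delta (g x0) (h b)"
      using b \<open>E \<noteq> F\<close> by (auto simp: G_def gate_def e_def f_def)
    then have "card (delta (G (g x0)) (h b)) < card (delta (g x0) (h b))"
      using finite_sub[OF gx0] b(1) by (simp add: psubset_card_mono)
    then have "S (G (g x0)) < S (g x0)"
      unfolding S_def using le[OF gx0] b(1) finite_V by (intro sum_strict_mono_ex1) auto
    moreover have "S (G (g x)) \<le> S (g x)" if "x \<in> Pow I" for x
      unfolding S_def using le g that by (intro sum_mono) (auto simp: R_def)
    ultimately have "(\<Sum>x\<in>Pow I. S ((G \<circ> g) x)) < (\<Sum>x\<in>Pow I. S (g x))"
      using x0 finite_I by (intro sum_strict_mono_ex1) auto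
    with least[OF \<open>R (G \<circ> g)\<close>] show False by simp
  qed
  with g that[of g] show thesis by (simp add: R_def)
qed

end

section \<open>Cops in a coloured cube\<close>

locale coloured_cube = median_cube V I h for V :: "'a set" and I :: "'i set" and h :: "'a \<Rightarrow> 'i set" +
  fixes col :: "'i \<Rightarrow> nat"
  assumes noncrossing: "E \<in> I \<Longrightarrow> F \<in> I \<Longrightarrow> E \<noteq> F \<Longrightarrow> col E = col F \<Longrightarrow>
    \<exists>e f. \<forall>a\<in>V. \<not> ((E \<in> h a) = e \<and> (F \<in> h a) = f)"
begin

lemma four_patterns:
  assumes "E \<in> I" "F \<in> I" "col E = col F"
    and "\<And>e f. \<exists>a\<in>V. (E \<in> h a) = e \<and> (F \<in> h a) = f"
  shows "E = F"
  using noncrossing[OF assms(1,2) _ assms(3)] assms(4) by blast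

text \<open>The witness \<open>a\<close> may vary with the colour. So these are the vertices of the
  product of the trees of the colours, in general more than the image of \<open>h\<close>.\<close>

definition realised :: "'i set \<Rightarrow> bool" where
  "realised x \<longleftrightarrow> x \<subseteq> I \<and> (\<forall>c. \<exists>a\<in>V. \<forall>E\<in>I. col E = c \<longrightarrow> (E \<in> x \<longleftrightarrow> E \<in> h a))"

definition legal :: "'i set \<Rightarrow> 'i set \<Rightarrow> bool" where
  "legal x x' \<longleftrightarrow> x' = x \<or> (\<exists>E\<in>I. x' = flip E x)"

definition gap :: "'i set \<Rightarrow> 'a \<Rightarrow> nat" where
  "gap x r = card (delta x (h r))"

text \<open>In the tree of colour \<open>c\<close> this is the part that the robber can reach only
  through the position of the cop. It is all of \<open>V\<close> if no class of this colour
  separates the two.\<close>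

definition behind :: "nat \<Rightarrow> 'i set \<Rightarrow> 'a \<Rightarrow> 'a set" where
  "behind c x r = {a \<in> V. \<forall>E\<in>delta x (h r). col E = c \<longrightarrow> (E \<in> h a \<longleftrightarrow> E \<in> x)}"

text \<open>The value \<open>card V + 1\<close> makes becoming separated from the robber in the colour \<open>c\<close> count as progress.\<close>

definition territory :: "'i set \<Rightarrow> 'a \<Rightarrow> nat \<Rightarrow> nat" where
  "territory x r c = (if \<exists>E\<in>delta x (h r). col E = c then card V - card (behind c x r) else card V + 1)"

text \<open>For at most two colours, the sum is smaller than the factor of the gap, so the order is lexicographic.\<close>

definition potential :: "nat set \<Rightarrow> 'i set \<Rightarrow> 'a \<Rightarrow> nat" where
  "potential C x r = gap x r * (2 * card V + 3) + (\<Sum>c\<in>C. territory x r c)"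

definition invar :: "nat set \<Rightarrow> 'i set \<Rightarrow> 'a \<Rightarrow> bool" where
  "invar C x r \<longleftrightarrow> realised x \<and> (card C = 2 \<longrightarrow> even (gap x r))"

lemma realised_subset: "realised x \<Longrightarrow> x \<subseteq> I"
  by (simp add: realised_def)

lemma realised_h: "a \<in> V \<Longrightarrow> realised (h a)"
  using h_subset by (auto simp: realised_def)

lemma delta_subset: "realised x \<Longrightarrow> r \<in> V \<Longrightarrow> delta x (h r) \<subseteq> I"
  using realised_subset[of x] h_subset[of r] by (auto simp: delta_def)

lemma finite_delta_realised: "realised x \<Longrightarrow> r \<in> V \<Longrightarrow> finite (delta x (h r))"
  using delta_subset finite_sub by blast

text \<open>Take a vertex that agrees with \<open>x\<close> in the colour of \<open>F\<close> and
  walk from it to \<open>r\<close> by a geodesic. Steps of other colours do not change the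
  projection to this colour, so the first step of this colour can be made by \<open>x\<close>
  itself.\<close>

lemma approach:
  assumes x: "realised x" and r: "r \<in> V" and F: "F \<in> delta x (h r)"
  shows "\<exists>E\<in>delta x (h r). col E = col F \<and> realised (flip E x)"
proof -
  have FI: "F \<in> I" using delta_subset[OF x r] F by blast
  have *: "\<exists>E\<in>delta (h a) (h r). col E = col F \<and> (\<exists>b\<in>V. \<forall>E'\<in>I. col E' = col F \<longrightarrow>
      (E' \<in> flip E (h a) \<longleftrightarrow> E' \<in> h b))"
    if "a \<in> V" "F \<in> delta (h a) (h r)" for a
    using that
  proof (induction "card (delta (h a) (h r))" arbitrary: a rule: less_induct)
    case less
    then have "a \<noteq> r" by auto
    then obtain a' E where a': "a' \<in> V" "E \<in> delta (h a) (h r)" "h a' = flip E (h a)"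
      using geodesic less.prems(1) r by blast
    show ?case
    proof (cases "col E = col F")
      case True
      then show ?thesis using a' by metis
    next
      case False
      have sub: "delta (h a') (h r) = delta (h a) (h r) - {E}"
        using a'(2) by (auto simp: a'(3))
      then have "card (delta (h a') (h r)) < card (delta (h a) (h r))"
        using a'(2) r less.prems(1) by (metis card_Diff1_less finite_delta finite_h)
      moreover have "F \<in> delta (h a') (h r)" using less.prems(2) False sub by auto
      ultimately obtain E1 b where E1: "E1 \<in> delta (h a') (h r)" "col E1 = col F" "b \<in> V"
        "\<forall>E'\<in>I. col E' = col F \<longrightarrow> (E' \<in> flip E1 (h a') \<longleftrightarrow> E' \<in> h b)"
        using less.hyps[OF _ a'(1)] by blast
      have "\<forall>E'\<in>I. col E' = col F \<longrightarrow> (E' \<in> flip E1 (h a) \<longleftrightarrow> E' \<in> h b)"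
        using E1(4) False a'(3) by auto
      with E1 sub show ?thesis by blast
    qed
  qed
  obtain a where a: "a \<in> V" "\<forall>E\<in>I. col E = col F \<longrightarrow> (E \<in> x \<longleftrightarrow> E \<in> h a)"
    using x unfolding realised_def by blast
  have "F \<in> delta (h a) (h r)" using a(2) F FI by auto
  then obtain E b where E: "E \<in> delta (h a) (h r)" "col E = col F" "b \<in> V"
      "\<forall>E'\<in>I. col E' = col F \<longrightarrow> (E' \<in> flip E (h a) \<longleftrightarrow> E' \<in> h b)"
    using *[OF a(1)] by blast
  have EI: "E \<in> I" using E(1) h_subset a(1) r by (auto simp: delta_def)
  have "realised (flip E x)"
    unfolding realised_def
  proof (intro conjI allI)
    show "flip E x \<subseteq> I" using flip_subset[OF realised_subset[OF x] EI] .
    show "\<exists>a\<in>V. \<forall>E'\<in>I. col E' = c \<longrightarrow> (E' \<in> flip E x \<longleftrightarrow> E' \<in> h a)" for c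
    proof (cases "c = col F")
      case True
      have "\<forall>E'\<in>I. col E' = c \<longrightarrow> (E' \<in> flip E x \<longleftrightarrow> E' \<in> h b)"
        using E(4) a(2) True by auto
      then show ?thesis using E(3) by blast
    next
      case False
      obtain a' where "a' \<in> V" "\<forall>E'\<in>I. col E' = c \<longrightarrow> (E' \<in> x \<longleftrightarrow> E' \<in> h a')"
        using x unfolding realised_def by blast
      moreover have "E' \<in> flip E x \<longleftrightarrow> E' \<in> x" if "col E' = c" for E'
        using False that E(2) by auto
      ultimately show ?thesis by blast
    qed
  qed
  moreover have "E \<in> delta x (h r)" using E(1,2) a(2) EI by auto
  ultimately show ?thesis using E(2) by blast
qed

lemma gap_flip:
  assumes "realised x" "r \<in> V" "E \<in> delta x (h r)"
  shows "gap (flip E x) r = gap x r - 1" "gap x r > 0"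
proof -
  have fin: "finite (delta x (h r))" using finite_delta_realised assms by blast
  have "delta (flip E x) (h r) = delta x (h r) - {E}" using assms(3) by auto
  then show "gap (flip E x) r = gap x r - 1" using fin assms(3) by (simp add: gap_def)
  show "gap x r > 0" using fin assms(3) by (auto simp: gap_def card_gt_0_iff)
qed

lemma robber_gap:
  assumes "realised x" "r \<in> V" "h r' = flip E (h r)"
  shows "E \<in> delta x (h r) \<Longrightarrow> gap x r' = gap x r - 1 \<and> gap x r > 0"
    and "E \<notin> delta x (h r) \<Longrightarrow> gap x r' = gap x r + 1"
proof -
  have fin: "finite (delta x (h r))" using finite_delta_realised assms by blast
  have eq: "delta x (h r') = flip E (delta x (h r))" using assms(3) by (simp add: delta_flip_right)
  show "gap x r' = gap x r - 1 \<and> gap x r > 0" if "E \<in> delta x (h r)"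
    using fin that by (auto simp: gap_def eq flip_def card_gt_0_iff)
  show "gap x r' = gap x r + 1" if "E \<notin> delta x (h r)"
    using fin that by (simp add: gap_def eq flip_def)
qed

section \<open>Territory in the tree of one colour\<close>

lemma behind_subset: "behind c x r \<subseteq> V"
  by (auto simp: behind_def)

text \<open>Crossing \<open>E\<close> drops one condition. The inclusion is strict because of a
  vertex that represents the new position of the cop in this colour: it lies beyond
  \<open>E\<close>.\<close>

lemma behind_grows:
  assumes x: "realised x" "realised (flip E x)" and r: "r \<in> V" and E: "E \<in> delta x (h r)"
  shows "behind (col E) x r \<subset> behind (col E) (flip E x) r"
proof -
  have sub: "delta x (h r) \<subseteq> I" using delta_subset[OF x(1) r] .
  have eq: "delta (flip E x) (h r) = delta x (h r) - {E}" using E by auto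
  have eq': "behind (col E) (flip E x) r =
      {a \<in> V. \<forall>E'\<in>delta x (h r) - {E}. col E' = col E \<longrightarrow> (E' \<in> h a \<longleftrightarrow> E' \<in> x)}"
    unfolding behind_def eq by auto
  have "behind (col E) x r \<subseteq> behind (col E) (flip E x) r"
    unfolding eq' unfolding behind_def by blast
  moreover obtain b where b: "b \<in> V" "\<forall>E'\<in>I. col E' = col E \<longrightarrow> (E' \<in> flip E x \<longleftrightarrow> E' \<in> h b)"
    using x(2) unfolding realised_def by blast
  moreover have "E \<in> h b \<longleftrightarrow> E \<notin> x" using b(2) E sub by auto
  then have "b \<notin> behind (col E) x r" unfolding behind_def using E by blast
  moreover have "b \<in> behind (col E) (flip E x) r"
  proof -
    have "E' \<in> h b \<longleftrightarrow> E' \<in> x" if "E' \<in> delta x (h r) - {E}" "col E' = col E" for E'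
    proof -
      have "E' \<in> I" "E' \<noteq> E" using that(1) sub by blast+
      then show ?thesis using b(2) that(2) by auto
    qed
    then show ?thesis unfolding eq' using b(1) by blast
  qed
  ultimately show ?thesis by blast
qed

text \<open>This is where classes of one colour must not cross. The cop's position and the robber's
  two positions show three patterns of \<open>E\<close> and \<open>F\<close>; a vertex behind the
  cop but across \<open>E\<close> would show the fourth.\<close>

lemma behind_robber_retreats:
  assumes x: "realised x" and r: "r \<in> V" "r' \<in> V" and E: "E \<in> I" "h r' = flip E (h r)" "E \<notin> delta x (h r)"
    and F: "F \<in> delta x (h r)" "col F = col E"
  shows "behind (col E) x r' = behind (col E) x r"
proof -
  have FI: "F \<in> I" using delta_subset[OF x r(1)] F by blast
  have "F \<noteq> E" using E F by auto
  obtain b where b: "b \<in> V" "\<forall>E'\<in>I. col E' = col E \<longrightarrow> (E' \<in> x \<longleftrightarrow> E' \<in> h b)"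
    using x unfolding realised_def by blast
  have "(E \<in> h a) = (E \<in> x)" if a: "a \<in> behind (col E) x r" for a
  proof (rule ccontr)
    assume neq: "(E \<in> h a) \<noteq> (E \<in> x)"
    have aV: "a \<in> V" "(F \<in> h a) = (F \<in> x)" using a F by (auto simp: behind_def)
    have "E = F"
    proof (rule four_patterns[OF E(1) FI F(2)[symmetric]])
      fix e f
      have "(E \<in> h b) = (E \<in> x)" "(F \<in> h b) = (F \<in> x)" using b(2) E(1) FI F(2) by auto
      then have "\<exists>a\<in>V. (E \<in> h a) = (E \<in> x) \<and> (F \<in> h a) = (F \<in> x)"
        using b(1) by blast
      moreover have "(E \<in> h r) = (E \<in> x)" "(F \<in> h r) \<noteq> (F \<in> x)"
        "(E \<in> h r') \<noteq> (E \<in> x)" "(F \<in> h r') \<noteq> (F \<in> x)"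
        using E(2,3) F(1) \<open>F \<noteq> E\<close> by auto
      then have "\<exists>a\<in>V. (E \<in> h a) = (E \<in> x) \<and> (F \<in> h a) \<noteq> (F \<in> x)"
        "\<exists>a\<in>V. (E \<in> h a) \<noteq> (E \<in> x) \<and> (F \<in> h a) \<noteq> (F \<in> x)"
        using r by blast+
      moreover have "\<exists>a\<in>V. (E \<in> h a) \<noteq> (E \<in> x) \<and> (F \<in> h a) = (F \<in> x)"
        using aV neq by blast
      ultimately show "\<exists>a\<in>V. (E \<in> h a) = e \<and> (F \<in> h a) = f"
        by (cases "e = (E \<in> x)"; cases "f = (F \<in> x)") simp_all
    qed
    with \<open>F \<noteq> E\<close> show False by simp
  qed
  moreover have "delta x (h r') = insert E (delta x (h r))"
    using E(3) unfolding E(2) delta_flip_right by (simp add: flip_def)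
  then have "behind (col E) x r' = {a \<in> behind (col E) x r. (E \<in> h a) = (E \<in> x)}"
    by (simp add: behind_def del: in_delta) blast
  ultimately show ?thesis by blast
qed

lemma territory_le: "territory x r c \<le> card V + 1"
  by (simp add: territory_def le_diff_conv)

lemma territory_sum_le:
  assumes "card C \<le> 2"
  shows "(\<Sum>c\<in>C. territory x r c) < 2 * card V + 3"
proof -
  have "(\<Sum>c\<in>C. territory x r c) \<le> card C * (card V + 1)"
    using sum_bounded_above[of C "territory x r" "card V + 1", OF territory_le] by simp
  also have "\<dots> \<le> 2 * (card V + 1)" using assms by (rule mult_le_mono1)
  finally show ?thesis by simp
qed

lemma potential_less_gap:
  assumes "card C \<le> 2" "gap x' r' < gap x r"
  shows "potential C x' r' < potential C x r"
proof -
  have "potential C x' r' < (gap x' r' + 1) * (2 * card V + 3)"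
    using territory_sum_le[OF assms(1), of x' r'] by (simp add: potential_def)
  also have "\<dots> \<le> gap x r * (2 * card V + 3)"
    using assms(2) by (intro mult_le_mono1) simp
  also have "\<dots> \<le> potential C x r" by (simp add: potential_def)
  finally show ?thesis .
qed

lemma territory_cong:
  assumes "realised x" "realised x'" "r \<in> V" "r' \<in> V"
    and eq: "\<And>F. F \<in> I \<Longrightarrow> col F = c \<Longrightarrow> (F \<in> x' \<longleftrightarrow> F \<in> x) \<and> (F \<in> h r' \<longleftrightarrow> F \<in> h r)"
  shows "territory x' r' c = territory x r c"
proof -
  have sep: "F \<in> delta x' (h r') \<longleftrightarrow> F \<in> delta x (h r)" if "col F = c" for F
    using eq[OF _ that] delta_subset[OF assms(1,3)] delta_subset[OF assms(2,4)] by auto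
  have "F \<in> x' \<longleftrightarrow> F \<in> x" if "col F = c" for F
    using eq[OF _ that] realised_subset assms(1,2) by blast
  then have "behind c x' r' = behind c x r"
    unfolding behind_def using sep by (simp del: in_delta) blast
  with sep show ?thesis
    unfolding territory_def by (simp del: in_delta) blast
qed

text \<open>The class \<open>F\<close> keeps the cop separated from the robber in this colour after
  his step; otherwise the territory would jump up to \<open>card V + 1\<close>.\<close>

lemma territory_shrinks:
  assumes x: "realised x" "realised (flip E x)" and r: "r \<in> V" and E: "E \<in> delta x (h r)"
    and F: "F \<in> delta (flip E x) (h r)" "col F = col E"
  shows "territory (flip E x) r (col E) < territory x r (col E)"
proof -
  have "card (behind (col E) x r) < card (behind (col E) (flip E x) r)"
    using behind_grows[OF x r E] behind_subset finite_V by (meson finite_subset psubset_card_mono)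
  \<comment> \<open>This bound keeps the truncated subtraction in \<open>territory\<close> strictly
    monotone.\<close>
  moreover have "card (behind (col E) (flip E x) r) \<le> card V"
    using behind_subset finite_V by (rule card_mono[rotated])
  ultimately show ?thesis
    unfolding territory_def using E F by (auto simp del: in_delta)
qed

section \<open>Answers of one cop to one move of the robber\<close>

definition reply :: "nat set \<Rightarrow> 'i set \<Rightarrow> 'a \<Rightarrow> 'a \<Rightarrow> 'i set \<Rightarrow> bool" where
  "reply C x r r' x' \<longleftrightarrow> legal x x' \<and> invar C x' r' \<and> potential C x' r' \<le> potential C x r \<and>
    (r' = r \<and> card C < 2 \<or> (\<exists>E\<in>I. col E \<in> C \<and> h r' = flip E (h r)) \<longrightarrow>
      potential C x' r' < potential C x r)"

text \<open>A cop with two colours must stand still, since a step would spoil the parity, and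
  nothing is asked of him. Any other cop comes closer.\<close>

lemma reply_exists_stay:
  assumes C: "card C \<le> 2" and inv: "invar C x r" and r: "r \<in> V" and pos: "0 < gap x r"
  shows "\<exists>x'. reply C x r r x'"
proof (cases "card C = 2")
  case True
  \<comment> \<open>So a pass is never mistaken for a move in a guarded colour, which would demand a
    strict decrease.\<close>
  have "h r \<noteq> flip E (h r)" for E by (metis in_flip)
  then show ?thesis using inv True by (intro exI[of _ x]) (auto simp: reply_def legal_def)
next
  case False
  have x: "realised x" using inv by (simp add: invar_def)
  obtain F where "F \<in> delta x (h r)" using pos unfolding gap_def
    by (metis card.empty equals0I less_numeral_extra(3))
  then obtain E where E: "E \<in> delta x (h r)" "realised (flip E x)"
    using approach[OF x r] by blast
  have EI: "E \<in> I" using delta_subset[OF x r] E by blast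
  have "potential C (flip E x) r < potential C x r"
    using gap_flip[OF x r E(1)] by (intro potential_less_gap[OF C]) simp
  then show ?thesis using E EI False by (intro exI[of _ "flip E x"]) (auto simp: reply_def legal_def invar_def)
qed

text \<open>A cop with two colours has to restore the parity. The robber's step has made the gap
  odd, hence positive, so there is a class left to cross, and the gap falls by two. Any other cop
  lets the robber's step count and stands still.\<close>

lemma reply_exists_toward:
  assumes C: "card C \<le> 2" and inv: "invar C x r" and r: "r \<in> V" "r' \<in> V" and pos: "0 < gap x r"
    and E: "E \<in> I" "h r' = flip E (h r)" "E \<in> delta x (h r)"
  shows "\<exists>x'. reply C x r r' x'"
proof -
  have x: "realised x" using inv by (simp add: invar_def)
  have d: "gap x r' = gap x r - 1" using robber_gap(1)[OF x r(1) E(2,3)] by simp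
  show ?thesis
  proof (cases "card C = 2")
    case True
    then have "even (gap x r)" using inv by (simp add: invar_def)
    then have "odd (gap x r')" using d pos by simp
    then obtain F where "F \<in> delta x (h r')" unfolding gap_def
      by (metis card.empty equals0I even_zero)
    then obtain E' where E': "E' \<in> delta x (h r')" "realised (flip E' x)"
      using approach[OF x r(2)] by blast
    have E'I: "E' \<in> I" using delta_subset[OF x r(2)] E' by blast
    have d': "gap (flip E' x) r' = gap x r - 2"
      using gap_flip[OF x r(2) E'(1)] d by simp
    have "potential C (flip E' x) r' < potential C x r"
      using d' pos by (intro potential_less_gap[OF C]) simp
    then show ?thesis using E' E'I d' \<open>even (gap x r)\<close>
      by (intro exI[of _ "flip E' x"]) (auto simp: reply_def legal_def invar_def)
  next
    case False
    have "potential C x r' < potential C x r"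
      using d pos by (intro potential_less_gap[OF C]) simp
    then show ?thesis using x False by (intro exI[of _ x]) (auto simp: reply_def legal_def invar_def)
  qed
qed

text \<open>The cop crosses one class so that the gap returns to its old value. Progress must
  therefore come from the territory, and the only question is in which colour to move without losing
  a separation elsewhere.\<close>

lemma reply_exists_away:
  assumes C: "finite C" "card C \<le> 2" and inv: "invar C x r" and r: "r \<in> V" "r' \<in> V" and pos: "0 < gap x r"
    and E: "E \<in> I" "h r' = flip E (h r)" "E \<notin> delta x (h r)"
  shows "\<exists>x'. reply C x r r' x'"
proof -
  have x: "realised x" using inv by (simp add: invar_def)
  have eq: "delta x (h r') = insert E (delta x (h r))"
    using E(3) unfolding E(2) delta_flip_right by (simp add: flip_def)
  have d: "gap x r' = gap x r + 1" using robber_gap(2)[OF x r(1) E(2,3)] .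
  have "r' \<noteq> r" using E(2) by (metis in_flip)
  have unique: "E' = E" if "h r' = flip E' (h r)" for E'
    using that E(2) by (metis in_flip)
  have replyI: "reply C x r r' (flip E' x)"
    if E': "E' \<in> delta x (h r')" "realised (flip E' x)"
      and le: "\<And>c. c \<in> C \<Longrightarrow> territory (flip E' x) r' c \<le> territory x r c"
      and less: "col E \<in> C \<Longrightarrow> territory (flip E' x) r' (col E) < territory x r (col E)" for E'
  proof -
    have d': "gap (flip E' x) r' = gap x r" using gap_flip[OF x r(2) E'(1)] d by simp
    have "E' \<in> I" using delta_subset[OF x r(2)] E' by blast
    have "(\<Sum>c\<in>C. territory (flip E' x) r' c) \<le> (\<Sum>c\<in>C. territory x r c)"
      using le by (rule sum_mono)
    moreover have "(\<Sum>c\<in>C. territory (flip E' x) r' c) < (\<Sum>c\<in>C. territory x r c)" if "col E \<in> C"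
      using le less[OF that] that C(1) by (intro sum_strict_mono_ex1) auto
    ultimately show ?thesis
      using d' E'(2) \<open>E' \<in> I\<close> inv \<open>r' \<noteq> r\<close> unique
      unfolding reply_def legal_def invar_def potential_def by auto
  qed
  have same: "territory (flip E' x) r' c = territory x r c"
    if "realised (flip E' x)" "c \<noteq> col E" "c \<noteq> col E'" for c E'
    by (rule territory_cong[OF x that(1) r]) (use that(2,3) E(2) in auto)
  show ?thesis
  proof (cases "col E \<in> C \<and> \<not> (\<exists>F\<in>delta x (h r). col F = col E)")
    \<comment> \<open>The cop follows in the colour of the robber's move; the territories of the
      other colours are unaffected.\<close>
    case False
    obtain E' where E': "E' \<in> delta x (h r')" "col E' = col E" "realised (flip E' x)"
      using approach[OF x r(2), of E] eq by blast
    have less: "territory (flip E' x) r' (col E) < territory x r (col E)" if "col E \<in> C"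
    proof -
      obtain F where F: "F \<in> delta x (h r)" "col F = col E" using False \<open>col E \<in> C\<close> by blast
      have "behind (col E) x r' = behind (col E) x r"
        by (rule behind_robber_retreats[OF x r E F])
      then have same_r: "territory x r' (col E) = territory x r (col E)"
        unfolding territory_def using F eq by (auto simp del: in_delta)
      \<comment> \<open>Two classes of this colour now separate the cop from the robber and he
        crosses only one, so he stays separated in it.\<close>
      have "E \<noteq> F" using F E(3) by blast
      then have "\<exists>F'\<in>{E, F}. F' \<noteq> E'" by (cases "E = E'") auto
      then obtain F' where "F' \<in> {E, F}" "F' \<noteq> E'" by blast
      then have F': "F' \<in> delta (flip E' x) (h r')" "col F' = col E'"
        using F eq E'(2) by (auto simp: delta_flip_left simp del: in_delta)
      have "territory (flip E' x) r' (col E) < territory x r' (col E)"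
        using territory_shrinks[OF x E'(3) r(2) E'(1) F'] E'(2) by simp
      then show ?thesis using same_r by simp
    qed
    have "reply C x r r' (flip E' x)"
    proof (rule replyI[OF E'(1,3) _ less])
      show "territory (flip E' x) r' c \<le> territory x r c" if "c \<in> C" for c
        using less same[OF E'(3)] E'(2) that by (cases "c = col E") auto
    qed
    then show ?thesis by blast
  next
    case True
    have fin: "finite (delta x (h r))" using finite_delta_realised[OF x r(1)] .
    \<comment> \<open>A class that can be crossed without making the cop level in his other guarded
      colour. If there were none, the separating classes would have distinct colours in
      \<open>C - {col E}\<close>. The gap would be at most 1 for two colours, against its parity,
      and 0 for one colour.\<close>
    have "\<exists>F\<in>delta x (h r). col F \<notin> C \<or> (\<exists>F2\<in>delta x (h r). F2 \<noteq> F \<and> col F2 = col F)"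
    proof (rule ccontr)
      assume neg: "\<not> ?thesis"
      then have sub: "col ` delta x (h r) \<subseteq> C - {col E}" using True by (auto simp del: in_delta)
      have "inj_on col (delta x (h r))" using neg by (auto simp: inj_on_def simp del: in_delta)
      then have "gap x r \<le> card (C - {col E})"
        unfolding gap_def using sub C(1) by (metis card_image card_mono finite_Diff)
      also have "\<dots> = card C - 1" using True C(1) by simp
      finally show False using pos C(2) inv by (auto simp: invar_def)
    qed
    then obtain F where F: "F \<in> delta x (h r)"
      "col F \<notin> C \<or> (\<exists>F2\<in>delta x (h r). F2 \<noteq> F \<and> col F2 = col F)" by blast
    obtain E' where E': "E' \<in> delta x (h r')" "col E' = col F" "realised (flip E' x)"
      using approach[OF x r(2), of F] F eq by blast
    have "col F \<noteq> col E" using True F(1) by blast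
    then have "E' \<noteq> E" using E'(2) by auto
    \<comment> \<open>The robber's own move has created the separation in this colour, so the value
      drops from \<open>card V + 1\<close> to at most \<open>card V\<close>.\<close>
    have less: "territory (flip E' x) r' (col E) < territory x r (col E)"
    proof -
      have "E \<in> delta (flip E' x) (h r')"
        using \<open>E' \<noteq> E\<close> eq by (simp add: delta_flip_left del: in_delta)
      then have "territory (flip E' x) r' (col E) \<le> card V" unfolding territory_def by auto
      also have "\<dots> < territory x r (col E)" unfolding territory_def using True by auto
      finally show ?thesis .
    qed
    have "reply C x r r' (flip E' x)"
    proof (rule replyI[OF E'(1,3) _ less])
      fix c assume "c \<in> C"
      consider "c = col E" | "c = col F" | "c \<noteq> col E" "c \<noteq> col F" by blast
      then show "territory (flip E' x) r' c \<le> territory x r c"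
      proof cases
        case 1 then show ?thesis using less by simp
      next
        case 2
        then obtain F2 where F2: "F2 \<in> delta x (h r)" "F2 \<noteq> F" "col F2 = col F"
          using F(2) \<open>c \<in> C\<close> by blast
        have "\<exists>F'\<in>{F, F2}. F' \<noteq> E'" using F2(2) by (cases "F = E'") auto
        then obtain F' where "F' \<in> {F, F2}" "F' \<noteq> E'" by blast
        then have F': "F' \<in> delta (flip E' x) (h r')" "col F' = col E'"
          using F(1) F2 eq E'(2) by (auto simp: delta_flip_left simp del: in_delta)
        have "territory (flip E' x) r' c < territory x r' c"
          using territory_shrinks[OF x E'(3) r(2) E'(1) F'] E'(2) 2 by simp
        also have "territory x r' c = territory x r c"
          by (rule territory_cong[OF x x r]) (use 2 \<open>col F \<noteq> col E\<close> E(2) in auto)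
        finally show ?thesis by simp
      next
        case 3 then show ?thesis using same[OF E'(3)] E'(2) by simp
      qed
    qed
    then show ?thesis by blast
  qed
qed

lemma reply_exists:
  assumes "finite C" "card C \<le> 2" "invar C x r" "r \<in> V" "r' \<in> V" "0 < gap x r"
    and "r' = r \<or> (\<exists>E\<in>I. h r' = flip E (h r))"
  shows "\<exists>x'. reply C x r r' x'"
  using assms reply_exists_stay reply_exists_toward reply_exists_away by metis

section \<open>From answers to a strategy on histories\<close>

definition opening_move :: "nat set \<Rightarrow> 'i set \<Rightarrow> 'a \<Rightarrow> 'i set" where
  "opening_move C x r = (if \<exists>x'. legal x x' \<and> invar C x' r then SOME x'. legal x x' \<and> invar C x' r else x)"

text \<open>The default value \<open>x\<close> keeps every move legal also for histories that are
  not plays or in which the robber has been caught; there no reply need exist.\<close>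

definition response :: "nat set \<Rightarrow> 'i set \<Rightarrow> 'a \<Rightarrow> 'a \<Rightarrow> 'i set" where
  "response C x r r' = (if \<exists>x'. reply C x r r' x' then SOME x'. reply C x r r' x' else x)"

text \<open>The history is given in reverse: the latest robber position comes first.\<close>

fun virtual_cop :: "nat set \<Rightarrow> 'i set \<Rightarrow> 'a list \<Rightarrow> 'i set" where
  "virtual_cop C x [] = x"
| "virtual_cop C x [r] = opening_move C x r"
| "virtual_cop C x (r' # r # rs) = response C (virtual_cop C x (r # rs)) r r'"

text \<open>The cops first move after the robber has chosen his start, and one step towards him
  changes the gap by one, which repairs the parity.\<close>

lemma opening_exists:
  assumes x: "realised x" and r: "r \<in> V"
  shows "\<exists>x'. legal x x' \<and> invar C x' r"
proof (cases "even (gap x r)")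
  case True
  then show ?thesis using x by (auto simp: legal_def invar_def)
next
  case False
  then obtain F where "F \<in> delta x (h r)" unfolding gap_def
    by (metis card.empty equals0I even_zero)
  then obtain E where E: "E \<in> delta x (h r)" "realised (flip E x)"
    using approach[OF x r] by blast
  have "even (gap (flip E x) r)" using gap_flip[OF x r E(1)] False by simp
  moreover have "E \<in> I" using delta_subset[OF x r] E by blast
  ultimately show ?thesis using E(2) by (auto simp: legal_def invar_def)
qed

lemma legal_opening: "legal x (opening_move C x r)"
proof -
  have "legal x (SOME x'. legal x x' \<and> invar C x' r)" if "\<exists>x'. legal x x' \<and> invar C x' r"
    using someI_ex[OF that] by blast
  then show ?thesis by (auto simp: opening_move_def legal_def)
qed

lemma legal_response: "legal x (response C x r r')"
proof -
  have "legal x (SOME x'. reply C x r r' x')" if "\<exists>x'. reply C x r r' x'"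
    using someI_ex[OF that] by (simp add: reply_def)
  then show ?thesis by (auto simp: response_def legal_def)
qed

lemma invar_opening:
  assumes "realised x" "r \<in> V"
  shows "invar C (opening_move C x r) r"
  using someI_ex[OF opening_exists[OF assms, of C]] opening_exists[OF assms, of C]
  by (simp add: opening_move_def)

lemma reply_response:
  assumes "\<exists>x'. reply C x r r' x'"
  shows "reply C x r r' (response C x r r')"
  using someI_ex[OF assms] assms by (simp add: response_def)

lemma legal_virtual_cop: "legal (virtual_cop C x rs) (virtual_cop C x (r # rs))"
  by (cases rs) (auto simp: legal_opening legal_response)

lemma legal_subset: "legal x x' \<Longrightarrow> x \<subseteq> I \<Longrightarrow> x' \<subseteq> I"
  unfolding legal_def by (metis flip_subset)

lemma virtual_cop_subset: "x \<subseteq> I \<Longrightarrow> virtual_cop C x rs \<subseteq> I"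
proof (induction rs)
  case (Cons r rs)
  then show ?case using legal_subset[OF legal_virtual_cop] by blast
qed simp

text \<open>Each cop stands at the vertex \<open>\<rho>\<close> of his virtual position. A legal
  virtual move changes at most one coordinate and \<open>g\<close> is nonexpansive, so
  \<open>\<rho>\<close> turns it into a step of \<open>M\<close>. Against a robber never caught, the
  sum of the potentials would decrease forever.\<close>

theorem cops_win_cube:
  fixes M :: "'a pair_pre_digraph"
  assumes verts: "pverts M = V"
    and arcs: "parcs M = {(a, b). a \<in> V \<and> b \<in> V \<and> (\<exists>E\<in>I. h b = flip E (h a))}"
    and col: "\<And>E. E \<in> I \<Longrightarrow> col E < t" and k: "0 < k" "t \<le> 2 * k - 1"
  shows "cops_win M k"
proof -
  obtain g where g: "\<And>x. x \<subseteq> I \<Longrightarrow> g x \<in> h ` V"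
    and g_ne: "\<And>x y. x \<subseteq> I \<Longrightarrow> y \<subseteq> I \<Longrightarrow> card (delta (g x) (g y)) \<le> card (delta x y)"
    and g_fix: "\<And>a. a \<in> V \<Longrightarrow> g (h a) = h a"
    using retraction by blast
  define \<rho> where "\<rho> x = (SOME a. a \<in> V \<and> h a = g x)" for x
  have \<rho>: "\<rho> x \<in> V \<and> h (\<rho> x) = g x" if "x \<subseteq> I" for x
  proof -
    have "\<exists>a. a \<in> V \<and> h a = g x" using g[OF that] by auto
    from someI_ex[OF this] show ?thesis unfolding \<rho>_def .
  qed
  have \<rho>_h: "\<rho> (h a) = a" if "a \<in> V" for a
    using \<rho>[OF h_subset[OF that]] g_fix[OF that] h_inj that by simp
  have \<rho>_step: "step M (\<rho> x) (\<rho> x')" if "x \<subseteq> I" "legal x x'" for x x'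
  proof -
    have x': "x' \<subseteq> I" using legal_subset that by blast
    have "card (delta x x') \<le> 1"
      using that(2) delta_singleton[of x x'] unfolding legal_def
      by (metis card_eq_0_iff card_1_singleton_iff delta_eq_empty le_numeral_extra(4) zero_le_one One_nat_def)
    then have le: "card (delta (g x) (g x')) \<le> 1" using g_ne[OF that(1) x'] by linarith
    have sub: "delta (g x) (g x') \<subseteq> I"
      using g[OF that(1)] g[OF x'] h_subset by (auto simp: delta_def)
    have "g x = g x' \<or> (\<exists>E\<in>I. g x' = flip E (g x))"
    proof (cases "delta (g x) (g x') = {}")
      case False
      then have "card (delta (g x) (g x')) = 1"
        using le finite_sub[OF sub] by (metis card_0_eq le_less less_one)
      then obtain E where "delta (g x) (g x') = {E}" by (auto simp: card_1_singleton_iff)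
      then show ?thesis using sub delta_singleton by (metis insert_subset)
    qed simp
    then have "\<rho> x = \<rho> x' \<or> (\<exists>E\<in>I. h (\<rho> x') = flip E (h (\<rho> x)))"
      using \<rho>[OF that(1)] \<rho>[OF x'] h_inj by metis
    then show ?thesis
      unfolding step_def verts arcs using \<rho>[OF that(1)] \<rho>[OF x'] by blast
  qed
  obtain m0 where m0: "m0 \<in> V" using V_nonempty by blast
  \<comment> \<open>The last cop has index \<open>k - 1\<close> and guards only
    \<open>2 * (k - 1)\<close>, so together the cops guard exactly the colours below
    \<open>2 * k - 1\<close>.\<close>
  define guards where "guards j = (if j < k - 1 then {2 * j, 2 * j + 1} else {2 * j})" for j :: nat
  have guards: "finite (guards j)" "card (guards j) \<le> 2" for j
    by (auto simp: guards_def card_insert_if)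
  \<comment> \<open>The position when \<open>n\<close> robber positions have been seen. Hence
    \<open>X r j (Suc n)\<close> is the answer to \<open>r n\<close>, and these two are compared
    below.\<close>
  define X where "X r j n = virtual_cop (guards j) (h m0) (rev (map r [0..<n]))" for r j and n :: nat
  have X_sub: "X r j n \<subseteq> I" for r j n
    unfolding X_def by (rule virtual_cop_subset[OF h_subset[OF m0]])
  have X_legal: "legal (X r j n) (X r j (Suc n))" for r j n
    unfolding X_def by (simp add: legal_virtual_cop)
  define \<sigma> where "\<sigma> rs = map (\<lambda>j. \<rho> (virtual_cop (guards j) (h m0) (rev rs))) [0..<k]" for rs
  have play: "cop_play \<sigma> r n = map (\<lambda>j. \<rho> (X r j n)) [0..<k]" for r n
    by (simp add: cop_play_def \<sigma>_def X_def)
  have "cop_strategy M k \<sigma>"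
    unfolding cop_strategy_def
  proof (intro conjI allI impI)
    show "length (\<sigma> []) = k" by (simp add: \<sigma>_def)
    show "set (\<sigma> []) \<subseteq> pverts M" using m0 \<rho>_h by (auto simp: \<sigma>_def verts)
    show "list_all2 (step M) (cop_play \<sigma> r n) (cop_play \<sigma> r (Suc n))" for r n
      unfolding play list_all2_conv_all_nth using \<rho>_step[OF X_sub X_legal] by simp
  qed
  moreover have "captured \<sigma> r" if r: "robber_play M r" for r
  proof (rule ccontr)
    assume nc: "\<not> captured \<sigma> r"
    have rV: "r n \<in> V" for n
      using r by (induction n) (auto simp: robber_play_def step_def verts)
    have r_step: "r (Suc n) = r n \<or> (\<exists>E\<in>I. h (r (Suc n)) = flip E (h (r n)))" for n
    proof -
      have "step M (r n) (r (Suc n))" using r by (simp add: robber_play_def)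
      then show ?thesis unfolding step_def arcs by auto
    qed
    \<comment> \<open>A virtual cop with gap 0 is at \<open>h (r n)\<close>, which
      \<open>\<rho>\<close> maps to \<open>r n\<close>: this is a real capture.\<close>
    have pos: "0 < gap (X r j (Suc n)) (r n)" if "j < k" for j n
    proof (rule ccontr)
      assume "\<not> ?thesis"
      then have "X r j (Suc n) = h (r n)"
        using finite_sub[OF X_sub, of r j "Suc n"] finite_h[OF rV] by (simp add: gap_def)
      then have "r n = \<rho> (X r j (Suc n))" using \<rho>_h rV by simp
      then have "r n \<in> set (cop_play \<sigma> r (Suc n))" unfolding play using that by simp
      then show False using nc by (auto simp: captured_def)
    qed
    have X_Suc: "X r j (Suc (Suc n)) = response (guards j) (X r j (Suc n)) (r n) (r (Suc n))" for j n
      by (simp add: X_def)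
    have replyI: "reply (guards j) (X r j (Suc n)) (r n) (r (Suc n)) (X r j (Suc (Suc n)))"
      if "j < k" "invar (guards j) (X r j (Suc n)) (r n)" for j n
      unfolding X_Suc
      by (rule reply_response[OF reply_exists[OF guards that(2) rV rV pos[OF that(1)] r_step]])
    have "invar (guards j) (X r j (Suc n)) (r n)" if "j < k" for j n
    proof (induction n)
      case 0
      show ?case using invar_opening[OF realised_h[OF m0] rV] by (simp add: X_def)
    next
      case (Suc n)
      then show ?case using replyI[OF that] by (simp add: reply_def)
    qed
    then have rep: "reply (guards j) (X r j (Suc n)) (r n) (r (Suc n)) (X r j (Suc (Suc n)))"
      if "j < k" for j n using that replyI by blast
    define P where "P n = (\<Sum>j<k. potential (guards j) (X r j (Suc n)) (r n))" for n
    have desc: "P (Suc n) < P n" for n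
      unfolding P_def
    proof (rule sum_strict_mono_ex1)
      show "\<forall>j\<in>{..<k}. potential (guards j) (X r j (Suc (Suc n))) (r (Suc n))
          \<le> potential (guards j) (X r j (Suc n)) (r n)"
        using rep by (auto simp: reply_def)
      \<comment> \<open>A pass is charged to the last cop, a move across \<open>E\<close> to the cop
        that guards \<open>col E\<close>.\<close>
      show "\<exists>j\<in>{..<k}. potential (guards j) (X r j (Suc (Suc n))) (r (Suc n))
          < potential (guards j) (X r j (Suc n)) (r n)"
        using r_step[of n]
      proof
        assume "r (Suc n) = r n"
        moreover have "card (guards (k - 1)) < 2" by (simp add: guards_def)
        ultimately show ?thesis
          using rep[of "k - 1" n] k(1) by (intro bexI[of _ "k - 1"]) (auto simp: reply_def)
      next
        assume "\<exists>E\<in>I. h (r (Suc n)) = flip E (h (r n))"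
        then obtain E where E: "E \<in> I" "h (r (Suc n)) = flip E (h (r n))" by blast
        have "col E div 2 < k" "col E \<in> guards (col E div 2)"
          using col[OF E(1)] k by (auto simp: guards_def)
        then show ?thesis
          using rep[of "col E div 2" n] E by (intro bexI[of _ "col E div 2"]) (auto simp: reply_def)
      qed
    qed simp
    have "P n + n \<le> P 0" for n
    proof (induction n)
      case (Suc n)
      then show ?case using desc[of n] by linarith
    qed simp
    from this[of "Suc (P 0)"] show False by simp
  qed
  ultimately show ?thesis unfolding cops_win_def by blast
qed

end

section \<open>Distances in connected graphs\<close>

lemma walk_iff_relpow:
  assumes "pair_wf_digraph G"
  shows "(\<exists>p. pre_digraph.awalk (with_proj G) u p v \<and> length p = n) \<longleftrightarrow>
    u \<in> pverts G \<and> (u, v) \<in> parcs G ^^ n"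
proof -
  interpret pair_wf_digraph G by fact
  show ?thesis
  proof (induction n arbitrary: u)
    case 0
    then show ?case by (auto simp: awalk_Nil_iff)
  next
    case (Suc n)
    have "(\<exists>p. awalk u p v \<and> length p = Suc n) \<longleftrightarrow> (\<exists>w. (u, w) \<in> parcs G \<and> (\<exists>p. awalk w p v \<and> length p = n))"
    proof (intro iffI; elim exE conjE)
      fix p assume "awalk u p v" "length p = Suc n"
      then obtain e es where "e \<in> parcs G" "u = fst e" "awalk (snd e) es v" "length es = n"
        by (cases p) (auto simp: awalk_Cons_iff)
      then show "\<exists>w. (u, w) \<in> parcs G \<and> (\<exists>p. awalk w p v \<and> length p = n)"
        by (intro exI[of _ "snd e"]) auto
    next
      fix w p assume "(u, w) \<in> parcs G" "awalk w p v" "length p = n"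
      then show "\<exists>p. awalk u p v \<and> length p = Suc n"
        by (intro exI[of _ "(u, w) # p"]) (simp add: awalk_Cons_iff)
    qed
    also have "\<dots> \<longleftrightarrow> u \<in> pverts G \<and> (\<exists>w. (u, w) \<in> parcs G \<and> (w, v) \<in> parcs G ^^ n)"
      unfolding Suc.IH using wellformed' by blast
    finally show ?case using relpow_Suc_I2 relpow_Suc_D2 by metis
  qed
qed

lemma gdist_relpow:
  assumes "pair_wf_digraph G" "u \<in> pverts G"
  shows "gdist G u v = (LEAST n. (u, v) \<in> parcs G ^^ n)"
  unfolding gdist_def walk_iff_relpow[OF assms(1)] using assms(2) by simp

text \<open>A common criterion for the distances in median graphs, in products and in the trees of
  the colours: \<open>lip\<close> bounds every walk from below, and \<open>descend\<close> together
  with \<open>lip\<close> yields a walk on which \<open>D\<close> drops by exactly one at each step.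
  The walk itself also gives connectedness.\<close>

lemma gdist_eqI:
  fixes D :: "'a \<Rightarrow> nat"
  assumes G: "pair_wf_digraph G" and x: "x \<in> pverts G"
    and zero: "\<And>x. x \<in> pverts G \<Longrightarrow> D x = 0 \<longleftrightarrow> x = y"
    and lip: "\<And>x x'. (x, x') \<in> parcs G \<Longrightarrow> D x \<le> D x' + 1"
    and descend: "\<And>x. x \<in> pverts G \<Longrightarrow> D x > 0 \<Longrightarrow> \<exists>x'. (x, x') \<in> parcs G \<and> D x' < D x"
  shows "gdist G x y = D x" "(x, y) \<in> parcs G ^^ D x"
proof -
  interpret pair_wf_digraph G by fact
  show walk: "(x, y) \<in> parcs G ^^ D x" using x
  proof (induction "D x" arbitrary: x)
    case 0
    then show ?case using zero[of x] by simp
  next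
    case (Suc n)
    obtain x' where x': "(x, x') \<in> parcs G" "D x' < D x" using descend[OF Suc.prems] Suc.hyps(2) by auto
    then have "n = D x'" using lip[OF x'(1)] Suc.hyps(2) by linarith
    then have "(x', y) \<in> parcs G ^^ n" using Suc.hyps(1)[of x'] wellformed'[OF x'(1)] by simp
    then show ?case using x'(1) Suc.hyps(2) by (metis relpow_Suc_I2)
  qed
  have le: "D x \<le> n" if "(x, y) \<in> parcs G ^^ n" "x \<in> pverts G" for n x
    using that
  proof (induction n arbitrary: x)
    case 0
    then show ?case using zero[of x] by simp
  next
    case (Suc n)
    then obtain x' where x': "(x, x') \<in> parcs G" "(x', y) \<in> parcs G ^^ n" by (meson relpow_Suc_D2)
    then show ?case using Suc.IH[of x'] wellformed'[OF x'(1)] lip[OF x'(1)] by simp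
  qed
  show "gdist G x y = D x"
    unfolding gdist_relpow[OF G x] using walk le[OF _ x] by (rule Least_equality)
qed

lemma connectedI:
  assumes "pair_graph G" "pverts G \<noteq> {}"
    and "\<And>u v. u \<in> pverts G \<Longrightarrow> v \<in> pverts G \<Longrightarrow> \<exists>n. (u, v) \<in> parcs G ^^ n"
  shows "connected (with_proj G)"
proof -
  interpret pair_graph G by fact
  have "parcs (mk_symmetric (with_proj G)) = parcs G"
    using adj_mk_symmetric_eq[OF sym_arcs] by simp
  moreover interpret S: pair_wf_digraph "mk_symmetric (with_proj G)" ..
  have "u \<rightarrow>\<^sup>*\<^bsub>mk_symmetric (with_proj G)\<^esub> v" if "u \<in> pverts G" "v \<in> pverts G" for u v
    using assms(3)[OF that] S.reachable_conv'[of u v] that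
    by (simp add: calculation rtrancl_power)
  ultimately show ?thesis
    unfolding connected_def using assms(2) by (intro strongly_connectedI) auto
qed

locale connected_graph = pair_graph G for G :: "'a pair_pre_digraph" +
  assumes connected: "connected (with_proj G)"
begin

abbreviation "d \<equiv> gdist G"

lemma verts_nonempty: "pverts G \<noteq> {}"
  using connected unfolding connected_def strongly_connected_def by simp

lemma walk_exists:
  assumes "u \<in> pverts G" "v \<in> pverts G"
  shows "\<exists>n. (u, v) \<in> parcs G ^^ n"
proof -
  have "strongly_connected (with_proj G)"
    using symmetric_connected_imp_strongly_connected[OF sym_arcs connected] .
  then have "u \<rightarrow>\<^sup>*\<^bsub>with_proj G\<^esub> v" using assms by (auto simp: strongly_connected_def)
  then show ?thesis using reachable_rtranclI[of "with_proj G" u v] by (simp add: rtrancl_power)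
qed

lemma walk_d:
  assumes "u \<in> pverts G" "v \<in> pverts G"
  shows "(u, v) \<in> parcs G ^^ d u v"
  unfolding gdist_relpow[OF pair_wf_digraph assms(1)] using walk_exists[OF assms] LeastI_ex by fast

lemma d_le: "u \<in> pverts G \<Longrightarrow> (u, v) \<in> parcs G ^^ n \<Longrightarrow> d u v \<le> n"
  unfolding gdist_relpow[OF pair_wf_digraph] by (rule Least_le)

lemma d_refl [simp]: "u \<in> pverts G \<Longrightarrow> d u u = 0"
  using d_le[of u u 0] by simp

lemma d_eq_0: "u \<in> pverts G \<Longrightarrow> v \<in> pverts G \<Longrightarrow> d u v = 0 \<longleftrightarrow> u = v"
  using walk_d[of u v] by auto

lemma d_triangle:
  "u \<in> pverts G \<Longrightarrow> v \<in> pverts G \<Longrightarrow> w \<in> pverts G \<Longrightarrow> d u w \<le> d u v + d v w"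
  by (intro d_le) (auto simp: relpow_add intro: walk_d)

lemma d_le_commute: "u \<in> pverts G \<Longrightarrow> v \<in> pverts G \<Longrightarrow> d v u \<le> d u v"
proof (intro d_le)
  assume "u \<in> pverts G" "v \<in> pverts G"
  have "(v, u) \<in> parcs G ^^ n" if "(u, v) \<in> parcs G ^^ n" for n
    using that
  proof (induction n arbitrary: v)
    case (Suc n)
    then obtain w where "(u, w) \<in> parcs G ^^ n" "(w, v) \<in> parcs G" by auto
    then show ?case using Suc.IH arcs_symmetric relpow_Suc_I2 by metis
  qed simp
  then show "(v, u) \<in> parcs G ^^ d u v" using walk_d \<open>u \<in> pverts G\<close> \<open>v \<in> pverts G\<close> by blast
qed

lemma d_commute: "u \<in> pverts G \<Longrightarrow> v \<in> pverts G \<Longrightarrow> d v u = d u v"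
  using d_le_commute by (metis le_antisym)

lemma d_arc: "(u, v) \<in> parcs G \<Longrightarrow> d u v = 1"
proof -
  assume a: "(u, v) \<in> parcs G"
  then have "d u v \<le> 1" using d_le[of u v 1] in_arcsD1 by simp
  moreover have "d u v \<noteq> 0" using d_eq_0[of u v] a wellformed'[OF a] no_loops' by blast
  ultimately show "d u v = 1" by linarith
qed

lemma d_arc_iff: "u \<in> pverts G \<Longrightarrow> v \<in> pverts G \<Longrightarrow> d u v = 1 \<longleftrightarrow> (u, v) \<in> parcs G"
  using d_arc walk_d[of u v] by auto

lemma d_lipschitz:
  assumes "(u, v) \<in> parcs G" "w \<in> pverts G"
  shows "d u w \<le> d v w + 1" "d v w \<le> d u w + 1" "d w u \<le> d w v + 1" "d w v \<le> d w u + 1"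
  using d_triangle[of u v w] d_triangle[of v u w] d_triangle[of w u v] d_triangle[of w v u]
    d_arc[OF assms(1)] d_arc[OF arcs_symmetric[OF assms(1)]] wellformed'[OF assms(1)] assms(2) by simp_all

lemma d_next:
  assumes "u \<in> pverts G" "v \<in> pverts G" "u \<noteq> v"
  obtains w where "(u, w) \<in> parcs G" "d u v = d w v + 1"
proof -
  obtain n where n: "d u v = Suc n" using d_eq_0[OF assms(1,2)] assms(3) by (metis not0_implies_Suc)
  then obtain w where w: "(u, w) \<in> parcs G" "(w, v) \<in> parcs G ^^ n"
    using walk_d[OF assms(1,2)] by (metis relpow_Suc_D2)
  then have "d w v \<le> n" using d_le in_arcsD2 by blast
  then have "d u v = d w v + 1" using n d_lipschitz(1)[OF w(1) assms(2)] by linarith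
  with w(1) that show thesis by blast
qed

text \<open>Two shortest walks of total length \<open>d u v\<close> concatenate to a path: at a
  repeated vertex a closed piece could be cut out, giving a shorter walk.\<close>

lemma interval_eq:
  assumes u: "u \<in> pverts G" and v: "v \<in> pverts G"
  shows "interval G u v = {w \<in> pverts G. d u w + d w v = d u v}"
proof (intro equalityI subsetI)
  fix w assume "w \<in> interval G u v"
  then obtain p where p: "apath u p v" "length p = d u v" "w \<in> set (awalk_verts u p)"
    by (auto simp: interval_def shortest_path_def)
  then obtain q r where qr: "p = q @ r" "awalk u q w" "awalk w r v"
    using awalk_decomp[of u p v w] by (auto simp: apath_def)
  then have w: "w \<in> pverts G" by auto
  have "d u w \<le> length q" "d w v \<le> length r"
    using qr(2,3) by (auto simp: gdist_def intro: Least_le)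
  then have "d u w + d w v \<le> d u v" using p(2) qr(1) by simp
  then show "w \<in> {w \<in> pverts G. d u w + d w v = d u v}"
    using d_triangle[OF u w v] w by simp
next
  fix w assume "w \<in> {w \<in> pverts G. d u w + d w v = d u v}"
  then have w: "w \<in> pverts G" "d u w + d w v = d u v" by auto
  obtain q where q: "awalk u q w" "length q = d u w"
    using walk_iff_relpow[OF pair_wf_digraph] walk_d[OF u w(1)] u by metis
  obtain r where r: "awalk w r v" "length r = d w v"
    using walk_iff_relpow[OF pair_wf_digraph] walk_d[OF w(1) v] w(1) by metis
  have qr: "awalk u (q @ r) v" "length (q @ r) = d u v"
    using q r w(2) awalk_appendI by auto
  have "distinct (awalk_verts u (q @ r))"
  proof (rule ccontr)
    assume "\<not> ?thesis"
    then obtain a b c y where abc: "q @ r = a @ b @ c" "0 < length b" "awalk u a y" "awalk y c v"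
      using awalk_not_distinct_decomp[OF qr(1)] by blast
    then have "d u v \<le> length (a @ c)"
      unfolding gdist_def using awalk_appendI by (intro Least_le) blast
    moreover have "length (a @ c) < length (q @ r)" unfolding abc(1) using abc(2) by simp
    ultimately show False using qr(2) by simp
  qed
  then have "shortest_path G u (q @ r) v" using qr by (simp add: shortest_path_def apath_def)
  moreover have "w \<in> set (awalk_verts u (q @ r))"
    using set_awalk_verts_append[OF q(1) r(1)] hd_in_awalk_verts(1)[OF r(1)] by blast
  ultimately show "w \<in> interval G u v" by (auto simp: interval_def)
qed

end

section \<open>Median graphs as subsets of a cube\<close>

locale median = connected_graph +
  assumes median: "x \<in> pverts G \<Longrightarrow> y \<in> pverts G \<Longrightarrow> z \<in> pverts G \<Longrightarrow>
    \<exists>!m. m \<in> interval G x y \<inter> interval G x z \<inter> interval G y z"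
begin

abbreviation is_median :: "'a \<Rightarrow> 'a \<Rightarrow> 'a \<Rightarrow> 'a \<Rightarrow> bool" where
  "is_median x y z m \<equiv> m \<in> pverts G \<and> d x m + d m y = d x y \<and> d x m + d m z = d x z \<and> d y m + d m z = d y z"

lemma median_ex1:
  assumes "x \<in> pverts G" "y \<in> pverts G" "z \<in> pverts G"
  shows "\<exists>!m. is_median x y z m"
proof -
  have "m \<in> interval G x y \<inter> interval G x z \<inter> interval G y z \<longleftrightarrow> is_median x y z m" for m
    by (auto simp: interval_eq assms)
  then show ?thesis using median[OF assms] by simp
qed

section \<open>Halfspaces and classes of edges\<close>

definition W :: "'a \<Rightarrow> 'a \<Rightarrow> 'a set" where
  "W u v = {a \<in> pverts G. d u a < d v a}"

text \<open>The median of \<open>u\<close>, \<open>v\<close>, \<open>w\<close> lies between the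
  adjacent \<open>u\<close> and \<open>v\<close>, hence is one of them, and this one is nearer to
  \<open>w\<close>. In other words, median graphs are bipartite.\<close>

lemma arc_d_neq:
  assumes "(u, v) \<in> parcs G" "w \<in> pverts G"
  shows "d u w \<noteq> d v w"
proof -
  have uv: "u \<in> pverts G" "v \<in> pverts G" using wellformed'[OF assms(1)] .
  obtain m where m: "is_median u v w m" using median_ex1[OF uv assms(2)] by blast
  then have "d u m + d m v = 1" using d_arc[OF assms(1)] by simp
  then consider "d u m = 0" | "d m v = 0" by linarith
  then show ?thesis
  proof cases
    case 1
    then have "m = u" using d_eq_0 m uv by blast
    then show ?thesis using m d_arc[OF arcs_symmetric[OF assms(1)]] by simp
  next
    case 2
    then have "m = v" using d_eq_0 m uv by blast
    then show ?thesis using m d_arc[OF assms(1)] by simp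
  qed
qed

lemma W_compl:
  assumes "(u, v) \<in> parcs G"
  shows "W v u = pverts G - W u v"
  using arc_d_neq[OF assms] by (auto simp: W_def) (meson nat_neq_iff)

lemma in_W:
  assumes "(u, v) \<in> parcs G" "a \<in> W u v"
  shows "a \<in> pverts G" "d v a = d u a + 1" "d a v = d a u + 1"
proof -
  show a: "a \<in> pverts G" using assms(2) by (simp add: W_def)
  show *: "d v a = d u a + 1" using assms(2) d_lipschitz(2)[OF assms(1) a] by (simp add: W_def)
  show "d a v = d a u + 1" using * d_commute a wellformed'[OF assms(1)] by simp
qed

lemma in_W_iff: "a \<in> W u v \<longleftrightarrow> a \<in> pverts G \<and> d u a < d v a"
  by (simp add: W_def)

lemma opposite_sides:
  assumes uv: "(u, v) \<in> parcs G" and xy: "(x, y) \<in> parcs G" and "x \<in> W u v" "y \<in> W v u"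
  shows "d v y = d u x" "d u y = d u x + 1" "d v x = d u x + 1"
  using in_W[OF uv assms(3)] in_W[OF arcs_symmetric[OF uv] assms(4)]
    d_lipschitz(3,4)[OF xy wellformed'(1)[OF uv]] d_lipschitz(3,4)[OF xy wellformed'(2)[OF uv]]
    arc_d_neq[OF xy wellformed'(1)[OF uv]] wellformed'[OF uv] wellformed'[OF xy]
  by (auto simp: d_commute)

text \<open>
  If \<open>w\<close> violates the inclusion, then \<open>y\<close> lies between \<open>x\<close> and \<open>w\<close>, and both the median of \<open>u, x, w\<close> and that
  of \<open>v, y, w\<close> are the median of \<open>v, x, w\<close>; but they lie on different sides of \<open>uv\<close>.
\<close>

lemma W_subset:
  assumes uv: "(u, v) \<in> parcs G" and xy: "(x, y) \<in> parcs G" and x: "x \<in> W u v" and y: "y \<in> W v u"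
  shows "W u v \<subseteq> W x y"
proof
  fix w assume w: "w \<in> W u v"
  have V: "u \<in> pverts G" "v \<in> pverts G" "x \<in> pverts G" "y \<in> pverts G" "w \<in> pverts G"
    using wellformed'[OF uv] wellformed'[OF xy] in_W(1)[OF uv w] by auto
  show "w \<in> W x y"
  proof (rule ccontr)
    assume "w \<notin> W x y"
    then have "w \<in> W y x" using W_compl[OF xy] V by simp
    then have xw: "d x w = d y w + 1" using in_W(2)[OF arcs_symmetric[OF xy]] by simp
    have vw: "d v w = d u w + 1" using in_W(2)[OF uv w] .
    note opp = opposite_sides[OF uv xy x y]
    obtain m1 where m1: "is_median u x w m1" using median_ex1[of u x w] V by blast
    obtain m2 where m2: "is_median v y w m2" using median_ex1[of v y w] V by blast
    have m1V: "m1 \<in> pverts G" and m2V: "m2 \<in> pverts G" using m1 m2 by auto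
    have 1: "is_median v x w m1"
      using m1 vw opp d_lipschitz(2)[OF uv m1V] d_triangle[OF V(2) m1V V(3)] d_triangle[OF V(2) m1V V(5)]
      by auto
    have 2: "is_median v x w m2"
      using m2 xw opp d_lipschitz(1,3)[OF xy m2V] d_triangle[OF V(2) m2V V(3)] d_triangle[OF V(3) m2V V(5)]
      by auto
    have "m1 = m2" using median_ex1[of v x w] V 1 2 by blast
    then show False
      using m1 m2 1 2 opp d_triangle[OF V(1) m2V V(4)] by auto
  qed
qed

lemma W_eq:
  assumes "(u, v) \<in> parcs G" "(x, y) \<in> parcs G" "x \<in> W u v" "y \<in> W v u"
  shows "W x y = W u v" "W y x = W v u"
proof -
  have s: "(v, u) \<in> parcs G" "(y, x) \<in> parcs G" using arcs_symmetric assms by auto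
  have "W u v \<subseteq> W x y" using W_subset[OF assms] .
  moreover have "W v u \<subseteq> W y x" using W_subset[OF s assms(4,3)] .
  moreover have "W u v \<subseteq> pverts G" "W x y \<subseteq> pverts G" by (auto simp: W_def)
  ultimately show "W x y = W u v" "W y x = W v u"
    using W_compl[OF assms(1)] W_compl[OF assms(2)] by blast+
qed

text \<open>A label for edges under which the relation \<open>Theta\<close> becomes equality of
  labels, so that it is visibly an equivalence and its classes are the fibres.\<close>

definition sides :: "'a set \<Rightarrow> 'a set set" where
  "sides e = {W u v | u v. (u, v) \<in> parcs G \<and> {u, v} = e}"

lemma sides_arc:
  assumes "(u, v) \<in> parcs G"
  shows "sides {u, v} = {W u v, W v u}"
  using assms arcs_symmetric by (auto simp: sides_def doubleton_eq_iff)

text \<open>If \<open>x\<close> and \<open>y\<close> lie on the same side of \<open>uv\<close>, both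
  sums grow by the same 1 and agree. If they lie on different sides, the sums differ by 2 and
  \<open>W_eq\<close> identifies the halfspaces.\<close>

lemma Theta_arc_iff:
  assumes uv: "(u, v) \<in> parcs G" and xy: "(x, y) \<in> parcs G"
  shows "d u x + d v y \<noteq> d u y + d v x \<longleftrightarrow> sides {u, v} = sides {x, y}"
proof -
  have V: "x \<in> pverts G" "y \<in> pverts G" using wellformed'[OF xy] by auto
  have s: "(v, u) \<in> parcs G" "(y, x) \<in> parcs G" using arcs_symmetric uv xy by auto
  have xyW: "x \<in> W x y" "y \<in> W y x" "y \<notin> W x y" "x \<notin> W y x"
    using V d_arc[OF xy] d_arc[OF s(2)] by (auto simp: W_def)
  consider "x \<in> W u v" "y \<in> W v u" | "x \<in> W v u" "y \<in> W u v" | "x \<in> W u v" "y \<in> W u v" | "x \<in> W v u" "y \<in> W v u"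
    using W_compl[OF uv] V by blast
  then show ?thesis
  proof cases
    case 1
    then show ?thesis
      using opposite_sides[OF uv xy 1] W_eq[OF uv xy 1] by (simp add: sides_arc uv xy)
  next
    case 2
    then show ?thesis
      using opposite_sides[OF s(1) xy 2] W_eq[OF s(1) xy 2] by (auto simp: sides_arc uv xy)
  next
    case 3
    have "sides {u, v} \<noteq> sides {x, y}"
      unfolding sides_arc[OF uv] sides_arc[OF xy] using 3 xyW by (metis doubleton_eq_iff)
    then show ?thesis using in_W(2)[OF uv 3(1)] in_W(2)[OF uv 3(2)] by simp
  next
    case 4
    have "sides {u, v} \<noteq> sides {x, y}"
      unfolding sides_arc[OF uv] sides_arc[OF xy] using 4 xyW by (metis doubleton_eq_iff)
    then show ?thesis using in_W(2)[OF s(1) 4(1)] in_W(2)[OF s(1) 4(2)] by simp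
  qed
qed

lemma Theta_eq: "Theta G = {(e, f). e \<in> edges G \<and> f \<in> edges G \<and> sides e = sides f}"
proof -
  have "(e, f) \<in> Theta G \<longleftrightarrow> (\<exists>u v x y. e = {u, v} \<and> f = {x, y} \<and> (u, v) \<in> parcs G \<and> (x, y) \<in> parcs G \<and>
      d u x + d v y \<noteq> d u y + d v x)" for e f
    by (simp add: Theta_def)
  also have "\<dots> e f \<longleftrightarrow> (\<exists>u v x y. e = {u, v} \<and> f = {x, y} \<and> (u, v) \<in> parcs G \<and> (x, y) \<in> parcs G \<and>
      sides {u, v} = sides {x, y})" for e f
    using Theta_arc_iff by (metis (no_types, lifting))
  also have "\<dots> e f \<longleftrightarrow> e \<in> edges G \<and> f \<in> edges G \<and> sides e = sides f" for e f
    unfolding edges_def by blast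
  finally show ?thesis by auto
qed

definition cls :: "'a \<Rightarrow> 'a \<Rightarrow> 'a set set" where
  "cls u v = {f \<in> edges G. sides f = {W u v, W v u}}"

lemma arc_edge: "(u, v) \<in> parcs G \<Longrightarrow> {u, v} \<in> edges G"
  by (auto simp: edges_def)

lemma Theta_classes_eq: "Theta_classes G = {cls u v | u v. (u, v) \<in> parcs G}"
proof -
  have cls: "cls u v = {f \<in> edges G. sides f = sides {u, v}}" if "(u, v) \<in> parcs G" for u v
    by (simp add: cls_def sides_arc[OF that])
  have "Theta_classes G = (\<lambda>e. {f \<in> edges G. sides f = sides e}) ` edges G"
    unfolding Theta_classes_def quotient_def Theta_eq by auto
  also have "\<dots> = {{f \<in> edges G. sides f = sides {u, v}} | u v. (u, v) \<in> parcs G}"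
    unfolding edges_def[of G] by blast
  also have "\<dots> = {cls u v | u v. (u, v) \<in> parcs G}"
    using cls by (intro Collect_cong ex_cong) blast
  finally show ?thesis .
qed

lemma in_cls_iff:
  assumes "(x, y) \<in> parcs G"
  shows "{x, y} \<in> cls u v \<longleftrightarrow> {W x y, W y x} = {W u v, W v u}"
  using assms by (simp add: cls_def arc_edge sides_arc)

lemma semicubes_cls:
  assumes "(u, v) \<in> parcs G"
  shows "semicubes G (cls u v) = {W u v, W v u}"
proof -
  have iff: "S \<in> semicubes G (cls u v) \<longleftrightarrow> (\<exists>x y. S = W x y \<and> (x, y) \<in> parcs G \<and> {x, y} \<in> cls u v)" for S
    by (simp add: semicubes_def W_def)
  show ?thesis
  proof (intro equalityI subsetI)
    fix S assume "S \<in> semicubes G (cls u v)"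
    then obtain x y where xy: "S = W x y" "(x, y) \<in> parcs G" "{x, y} \<in> cls u v"
      unfolding iff by blast
    then have "{W x y, W y x} = {W u v, W v u}" using in_cls_iff by simp
    then show "S \<in> {W u v, W v u}" unfolding xy(1) by (metis insertI1)
  next
    fix S assume "S \<in> {W u v, W v u}"
    then consider "S = W u v" | "S = W v u" by blast
    then show "S \<in> semicubes G (cls u v)"
    proof cases
      case 1
      have "{u, v} \<in> cls u v" using in_cls_iff[OF assms] by simp
      then show ?thesis unfolding iff 1 using assms by (intro exI[of _ u] exI[of _ v]) simp
    next
      case 2
      have "{v, u} \<in> cls u v" using in_cls_iff[OF arcs_symmetric[OF assms], of u v] by (simp add: insert_commute)
      then show ?thesis unfolding iff 2 using arcs_symmetric[OF assms] by (intro exI[of _ v] exI[of _ u]) simp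
    qed
  qed
qed

lemma semicubes_inj:
  assumes "E \<in> Theta_classes G" "F \<in> Theta_classes G" "semicubes G E = semicubes G F"
  shows "E = F"
proof -
  have "E = {f \<in> edges G. sides f = semicubes G E}" if E: "E \<in> Theta_classes G" for E
  proof -
    obtain u v where uv: "(u, v) \<in> parcs G" "E = cls u v" using E unfolding Theta_classes_eq by blast
    show ?thesis unfolding uv(2) semicubes_cls[OF uv(1)] by (simp add: cls_def)
  qed
  then show ?thesis using assms by metis
qed

text \<open>An arbitrary orientation of the class: it decides which semicube gets the bit 1 in the
  cube.\<close>

definition side :: "'a set set \<Rightarrow> 'a set" where
  "side E = (SOME S. S \<in> semicubes G E)"

lemma semicubes_side:
  assumes "E \<in> Theta_classes G"
  shows "semicubes G E = {side E, pverts G - side E}" "side E \<subseteq> pverts G" "side E \<noteq> {}" "side E \<noteq> pverts G"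
proof -
  obtain u v where uv: "(u, v) \<in> parcs G" "E = cls u v" using assms unfolding Theta_classes_eq by blast
  have sc: "semicubes G E = {W u v, W v u}" using semicubes_cls[OF uv(1)] uv(2) by simp
  then have "side E \<in> semicubes G E" unfolding side_def by (metis insertI1 someI)
  then have "side E = W u v \<or> side E = W v u" unfolding sc by simp
  then have "\<exists>x y. (x, y) \<in> parcs G \<and> semicubes G E = {W x y, W y x} \<and> side E = W x y"
  proof
    assume "side E = W u v"
    then show ?thesis using uv(1) sc by blast
  next
    assume "side E = W v u"
    then show ?thesis
      using arcs_symmetric[OF uv(1)] sc by (intro exI[of _ v] exI[of _ u]) (simp add: insert_commute)
  qed
  then obtain x y where xy: "(x, y) \<in> parcs G" "semicubes G E = {W x y, W y x}" "side E = W x y"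
    by blast
  show "semicubes G E = {side E, pverts G - side E}" "side E \<subseteq> pverts G"
    unfolding xy(2,3) W_compl[OF xy(1)] by (auto simp: W_def)
  have "x \<in> W x y" "y \<notin> W x y" "y \<in> pverts G"
    using wellformed'[OF xy(1)] d_arc[OF xy(1)] d_arc[OF arcs_symmetric[OF xy(1)]] by (auto simp: W_def)
  then show "side E \<noteq> {}" "side E \<noteq> pverts G" unfolding xy(3) by blast+
qed

section \<open>The embedding into the cube of classes\<close>

definition hc :: "'a \<Rightarrow> 'a set set set" where
  "hc a = {E \<in> Theta_classes G. a \<in> side E}"

text \<open>The symmetric difference does not see which of the two semicubes \<open>side\<close> has
  selected.\<close>

lemma separates_iff:
  assumes "(u, v) \<in> parcs G" "a \<in> pverts G" "b \<in> pverts G"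
  shows "cls u v \<in> delta (hc a) (hc b) \<longleftrightarrow> (a \<in> W u v) \<noteq> (b \<in> W u v)"
proof -
  have E: "cls u v \<in> Theta_classes G" using assms(1) by (auto simp: Theta_classes_eq)
  have "side (cls u v) \<in> {W u v, W v u}"
    using semicubes_side(1)[OF E] semicubes_cls[OF assms(1)] by blast
  then show ?thesis using E W_compl[OF assms(1)] assms(2,3) by (auto simp: hc_def)
qed

text \<open>An edge crosses no class but its own: if \<open>W u v\<close> separates its ends, then
  by \<open>W_eq\<close> the edge has the same two halfspaces as \<open>uv\<close>.\<close>

lemma hc_arc:
  assumes ab: "(a, b) \<in> parcs G"
  shows "hc b = flip (cls a b) (hc a)" "cls a b \<in> Theta_classes G"
proof -
  have V: "a \<in> pverts G" "b \<in> pverts G" using wellformed'[OF ab] by auto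
  show cl: "cls a b \<in> Theta_classes G" using ab by (auto simp: Theta_classes_eq)
  have abW: "a \<in> W a b" "b \<notin> W a b"
    using V d_arc[OF ab] d_arc[OF arcs_symmetric[OF ab]] by (auto simp: W_def)
  have "E = cls a b" if E: "E \<in> delta (hc a) (hc b)" for E
  proof -
    have "E \<in> Theta_classes G" using E by (auto simp: hc_def)
    then obtain u v where uv: "(u, v) \<in> parcs G" "E = cls u v" by (auto simp: Theta_classes_eq)
    then have "(a \<in> W u v) \<noteq> (b \<in> W u v)" using separates_iff[OF uv(1) V] E by simp
    then have "{W a b, W b a} = {W u v, W v u}"
      using W_eq[OF uv(1) ab] W_eq[OF arcs_symmetric[OF uv(1)] ab] W_compl[OF uv(1)] V by blast
    then show ?thesis using uv(2) by (simp add: cls_def)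
  qed
  moreover have "cls a b \<in> delta (hc a) (hc b)" using separates_iff[OF ab V] abW by simp
  ultimately show "hc b = flip (cls a b) (hc a)" unfolding delta_singleton[symmetric] by blast
qed

text \<open>The first edge of a shortest path to \<open>b\<close> separates \<open>a\<close> from
  \<open>b\<close>, because \<open>b\<close> is nearer to its other end.\<close>

lemma hc_geodesic:
  assumes ab: "a \<in> pverts G" "b \<in> pverts G" "a \<noteq> b"
  obtains a' where "(a, a') \<in> parcs G" "cls a a' \<in> delta (hc a) (hc b)" "hc a' = flip (cls a a') (hc a)"
proof -
  obtain a' where a': "(a, a') \<in> parcs G" "d a b = d a' b + 1" using d_next[OF ab] by blast
  have "a \<in> W a a'" "b \<notin> W a a'"
    using ab a' d_arc[OF arcs_symmetric[OF a'(1)]] by (auto simp: W_def)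
  then have "cls a a' \<in> delta (hc a) (hc b)" using separates_iff[OF a'(1) ab(1,2)] by simp
  with a'(1) hc_arc(1)[OF a'(1)] that show thesis by blast
qed

lemma finite_Theta_classes: "finite (Theta_classes G)"
proof -
  have "Theta_classes G = (\<lambda>(u, v). cls u v) ` parcs G" by (auto simp: Theta_classes_eq)
  then show ?thesis using pair_finite_arcs by simp
qed

lemma finite_hc [simp]: "finite (hc a)"
  using finite_Theta_classes by (simp add: hc_def)

lemma d_eq_card:
  assumes "a \<in> pverts G" "b \<in> pverts G"
  shows "d a b = card (delta (hc a) (hc b))"
proof (rule gdist_eqI(1)[OF pair_wf_digraph assms(1)])
  show "card (delta (hc x) (hc b)) = 0 \<longleftrightarrow> x = b" if x: "x \<in> pverts G" for x
  proof
    assume "card (delta (hc x) (hc b)) = 0"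
    then show "x = b" using hc_geodesic[OF x assms(2)] by (metis card_0_eq empty_iff finite_delta finite_hc)
  qed (use delta_eq_empty in simp)
  show "card (delta (hc x) (hc b)) \<le> card (delta (hc x') (hc b)) + 1" if x: "(x, x') \<in> parcs G" for x x'
  proof -
    have "delta (hc x) (hc b) \<subseteq> insert (cls x x') (delta (hc x') (hc b))"
      using hc_arc(1)[OF x] by auto
    then have "card (delta (hc x) (hc b)) \<le> card (insert (cls x x') (delta (hc x') (hc b)))"
      by (intro card_mono) auto
    then show ?thesis using card_insert_le_m1 by (metis Suc_eq_plus1 card_insert_if finite_delta finite_hc le_SucI)
  qed
  show "\<exists>x'. (x, x') \<in> parcs G \<and> card (delta (hc x') (hc b)) < card (delta (hc x) (hc b))"
    if x: "x \<in> pverts G" "card (delta (hc x) (hc b)) > 0" for x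
  proof -
    have "x \<noteq> b" using x(2) by auto
    then obtain x' where x': "(x, x') \<in> parcs G" "cls x x' \<in> delta (hc x) (hc b)"
      "hc x' = flip (cls x x') (hc x)" using hc_geodesic[OF x(1) assms(2)] by blast
    have "delta (hc x') (hc b) = delta (hc x) (hc b) - {cls x x'}"
      using x'(2) by (auto simp: x'(3))
    then show ?thesis using x' by (metis card_Diff1_less finite_delta finite_hc)
  qed
qed

text \<open>Semicubes are convex: a class separating \<open>m\<close> from both \<open>a\<close> and
  \<open>b\<close> would be counted in both distances but not in \<open>d a b\<close>, so the sum
  would be too large.\<close>

lemma between_same_side:
  assumes V: "a \<in> pverts G" "b \<in> pverts G" "m \<in> pverts G" and eq: "d a m + d m b = d a b"
    and E: "E \<notin> delta (hc a) (hc b)"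
  shows "E \<notin> delta (hc a) (hc m)"
proof
  assume am: "E \<in> delta (hc a) (hc m)"
  have "delta (hc a) (hc b) \<subseteq> (delta (hc a) (hc m) - {E}) \<union> delta (hc m) (hc b)" using E by auto
  then have "d a b \<le> card ((delta (hc a) (hc m) - {E}) \<union> delta (hc m) (hc b))"
    unfolding d_eq_card[OF V(1,2)] by (intro card_mono) auto
  also have "\<dots> \<le> card (delta (hc a) (hc m) - {E}) + d m b"
    unfolding d_eq_card[OF V(3,2)] by (rule card_Un_le)
  also have "\<dots> < d a m + d m b"
    unfolding d_eq_card[OF V(1,3)] using am by (metis add_less_mono1 card_Diff1_less finite_delta finite_hc)
  finally show False using eq by simp
qed

sublocale cube: median_cube "pverts G" "Theta_classes G" hc
proof
  show "finite (pverts G)" by (rule pair_finite_verts)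
  show "pverts G \<noteq> {}" by (rule verts_nonempty)
  show "finite (Theta_classes G)" by (rule finite_Theta_classes)
  show "hc a \<subseteq> Theta_classes G" for a by (auto simp: hc_def)
  show "\<exists>a'\<in>pverts G. \<exists>E\<in>delta (hc a) (hc b). hc a' = flip E (hc a)"
    if "a \<in> pverts G" "b \<in> pverts G" "a \<noteq> b" for a b
    using hc_geodesic[OF that] in_arcsD2 by metis
  show "\<exists>m\<in>pverts G. hc m = (hc a \<inter> hc b) \<union> (hc a \<inter> hc c) \<union> (hc b \<inter> hc c)"
    if V: "a \<in> pverts G" "b \<in> pverts G" "c \<in> pverts G" for a b c
  proof -
    obtain m where m: "is_median a b c m" using median_ex1[OF V] by blast
    then have mV: "m \<in> pverts G" by blast
    \<comment> \<open>For each class two of the three vertices are on the same side; the median lies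
      between them, so convexity puts it on the majority side.\<close>
    have "E \<notin> delta (hc a) (hc b) \<Longrightarrow> E \<notin> delta (hc a) (hc m)"
      "E \<notin> delta (hc a) (hc c) \<Longrightarrow> E \<notin> delta (hc a) (hc m)"
      "E \<notin> delta (hc b) (hc c) \<Longrightarrow> E \<notin> delta (hc b) (hc m)" for E
      using m between_same_side[OF V(1,2) mV] between_same_side[OF V(1,3) mV] between_same_side[OF V(2,3) mV]
      by blast+
    then have "E \<in> hc m \<longleftrightarrow> E \<in> (hc a \<inter> hc b) \<union> (hc a \<inter> hc c) \<union> (hc b \<inter> hc c)" for E
      unfolding in_delta by (metis Int_iff Un_iff)
    then show ?thesis using mV by blast
  qed
  show "(\<exists>a\<in>pverts G. E \<in> hc a) \<and> (\<exists>a\<in>pverts G. E \<notin> hc a)" if "E \<in> Theta_classes G" for E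
    using semicubes_side[OF that] that by (auto simp: hc_def)
  show "(\<exists>a\<in>pverts G. (E \<in> hc a) = (F \<in> hc a)) \<and> (\<exists>a\<in>pverts G. (E \<in> hc a) \<noteq> (F \<in> hc a))"
    if EF: "E \<in> Theta_classes G" "F \<in> Theta_classes G" "E \<noteq> F" for E F
  proof (rule ccontr)
    assume "\<not> ?thesis"
    then consider "\<forall>a\<in>pverts G. (E \<in> hc a) \<noteq> (F \<in> hc a)" | "\<forall>a\<in>pverts G. (E \<in> hc a) = (F \<in> hc a)" by blast
    \<comment> \<open>Equal or complementary coordinates have the same pair of semicubes, and this
      pair determines the class.\<close>
    then have "side F = pverts G - side E \<or> side F = side E"
    proof cases
      case 1
      then have "side F = pverts G - side E" using EF(1,2) semicubes_side(2) by (auto simp: hc_def)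
      then show ?thesis ..
    next
      case 2
      then have "side F = side E" using EF(1,2) semicubes_side(2) by (auto simp: hc_def)
      then show ?thesis ..
    qed
    then have "semicubes G E = semicubes G F"
      using semicubes_side(1,2)[OF EF(1)] semicubes_side(1)[OF EF(2)] by (auto simp: double_diff)
    then show False using semicubes_inj EF by blast
  qed
qed

text \<open>Adjacency is distance 1, and the embedding preserves distances; this is the form of the
  graph that the pursuit in the cube expects.\<close>

lemma parcs_eq: "parcs G = {(a, b). a \<in> pverts G \<and> b \<in> pverts G \<and> (\<exists>E\<in>Theta_classes G. hc b = flip E (hc a))}"
proof -
  have 1: "(a, b) \<in> parcs G" if "a \<in> pverts G" "b \<in> pverts G" "hc b = flip E (hc a)" for a b E
  proof -
    have "delta (hc a) (hc b) = {E}" using that(3) by (simp only: delta_singleton)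
    then show ?thesis using that(1,2) d_arc_iff[of a b] d_eq_card[of a b] by simp
  qed
  have 2: "\<exists>E\<in>Theta_classes G. hc b = flip E (hc a)" if "(a, b) \<in> parcs G" for a b
    using hc_arc[OF that] by (intro bexI)
  show ?thesis
  proof (intro equalityI subrelI)
    show "(a, b) \<in> {(a, b). a \<in> pverts G \<and> b \<in> pverts G \<and> (\<exists>E\<in>Theta_classes G. hc b = flip E (hc a))}"
      if "(a, b) \<in> parcs G" for a b
      using wellformed'[OF that] 2[OF that] by simp
    show "(a, b) \<in> parcs G"
      if "(a, b) \<in> {(a, b). a \<in> pverts G \<and> b \<in> pverts G \<and> (\<exists>E\<in>Theta_classes G. hc b = flip E (hc a))}"
      for a b
      using that by (elim CollectE case_prodE conjE bexE Pair_inject) (simp only: 1)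
  qed
qed

lemma cross_iff:
  assumes "E \<in> Theta_classes G" "F \<in> Theta_classes G"
  shows "cross G E F \<longleftrightarrow> (\<forall>e f. \<exists>a\<in>pverts G. (E \<in> hc a) = e \<and> (F \<in> hc a) = f)"
  unfolding cross_def all_bool_eq
  using semicubes_side(1,2)[OF assms(1)] semicubes_side(1,2)[OF assms(2)] assms
  by (auto simp: hc_def)

lemma coloured_cubeI:
  assumes "proper_colouring (crossing_graph G) k c"
  shows "coloured_cube (pverts G) (Theta_classes G) hc c"
proof
  fix E F assume EF: "E \<in> Theta_classes G" "F \<in> Theta_classes G" "E \<noteq> F" "c E = c F"
  then have "\<not> cross G E F"
    using assms by (auto simp: proper_colouring_def crossing_graph_def)
  then show "\<exists>e f. \<forall>a\<in>pverts G. \<not> ((E \<in> hc a) = e \<and> (F \<in> hc a) = f)"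
    using cross_iff[OF EF(1,2)] by blast
qed

lemma cops_win_colouring:
  assumes c: "proper_colouring (crossing_graph G) t c" and k: "0 < k" "t \<le> 2 * k - 1"
  shows "cops_win G k"
proof -
  interpret coloured_cube "pverts G" "Theta_classes G" hc c
    by (rule coloured_cubeI[OF c])
  show ?thesis
    using c by (intro cops_win_cube[OF refl parcs_eq _ k]) (auto simp: proper_colouring_def crossing_graph_def)
qed

end

lemma median_graph_median: "median_graph M \<Longrightarrow> median M"
  unfolding median_graph_def median_def connected_graph_def connected_graph_axioms_def median_axioms_def by blast

section \<open>Trees\<close>

abbreviation deleted :: "'a pair_pre_digraph \<Rightarrow> 'a \<Rightarrow> 'a \<Rightarrow> 'a rel" where
  "deleted G a b \<equiv> parcs G - {(a, b), (b, a)}"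

lemma (in connected_graph) walk_in_subrel:
  assumes "(a, b) \<in> R\<^sup>*" "R \<subseteq> parcs G" "b \<in> pverts G"
  shows "\<exists>p. awalk a p b \<and> set p \<subseteq> R"
  using assms(1)
proof (induction rule: converse_rtrancl_induct)
  case base
  then show ?case using assms(3) by (intro exI[of _ "[]"]) (simp add: awalk_Nil_iff)
next
  case (step y z)
  then obtain p where "awalk z p b" "set p \<subseteq> R" by blast
  then show ?case using step(1) assms(2) by (intro exI[of _ "(y, z) # p"]) (auto simp: awalk_Cons_iff)
qed

lemma (in connected_graph) awalk_imp_rtrancl:
  "awalk a p b \<Longrightarrow> set p \<subseteq> R \<Longrightarrow> (a, b) \<in> R\<^sup>*"
proof (induction p arbitrary: a)
  case Nil
  then show ?case by (simp add: awalk_Nil_iff)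
next
  case (Cons e p)
  then have "(a, snd e) \<in> R" "(snd e, b) \<in> R\<^sup>*" by (auto simp: awalk_Cons_iff)
  then show ?case by (rule converse_rtrancl_into_rtrancl)
qed

text \<open>A walk that bypasses the edge shortens to a path that still avoids it. This path has
  length at least 2, and the edge closes it to a cycle of length at least 3.\<close>

lemma undirected_tree_bridge:
  assumes T: "undirected_tree T" and ab: "(a, b) \<in> parcs T"
  shows "(a, b) \<notin> (deleted T a b)\<^sup>*"
proof
  assume *: "(a, b) \<in> (deleted T a b)\<^sup>*"
  interpret connected_graph T
    using T by (simp add: undirected_tree_def connected_graph_def connected_graph_axioms_def)
  obtain p where p: "awalk a p b" "set p \<subseteq> deleted T a b"
    using walk_in_subrel[OF * _ in_arcsD2[OF ab]] by blast
  define q where "q = awalk_to_apath p"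
  have q: "apath a q b" "set q \<subseteq> deleted T a b"
    using p awalk_to_apath_subset[OF p(1)] apath_awalk_to_apath[OF p(1)] by (auto simp: q_def)
  have "a \<noteq> b" using ab no_loops' by blast
  have "2 \<le> length q"
  proof (rule ccontr)
    assume "\<not> ?thesis"
    then consider "q = []" | e where "q = [e]" by (cases q; cases "tl q") auto
    then show False
    proof cases
      case 1 then show ?thesis using q(1) \<open>a \<noteq> b\<close> by (simp add: apath_Nil_iff)
    next
      case 2
      then have "e = (a, b)" using q(1) by (cases e) (simp add: apath_Cons_iff apath_Nil_iff)
      then show ?thesis using q(2) 2 by simp
    qed
  qed
  have aw: "awalk a (q @ [(b, a)]) a"
    using q(1) arcs_symmetric[OF ab] in_arcsD1[OF ab]
    by (intro awalk_appendI[of a q b]) (auto simp: apath_def awalk_Cons_iff awalk_Nil_iff)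
  have "awalk_verts a (q @ [(b, a)]) = awalk_verts a q @ [a]"
    using awalk_verts_append[OF aw] by simp
  moreover obtain ys where "awalk_verts a q = a # ys"
    using q(1) \<open>2 \<le> length q\<close> by (cases q) (auto simp: apath_def awalk_Cons_iff)
  ultimately have "distinct (tl (awalk_verts a (q @ [(b, a)])))"
    using q(1) by (simp add: apath_def)
  then have "cycle (q @ [(b, a)])" using aw unfolding cycle_def by blast
  moreover have "3 \<le> length (q @ [(b, a)])" using \<open>2 \<le> length q\<close> by simp
  ultimately show False using T unfolding undirected_tree_def by blast
qed

text \<open>Without its first edge, a cycle of length at least 3 is a path between the ends of that
  edge which uses it in neither direction, so the edge is no bridge.\<close>

lemma (in connected_graph) undirected_treeI:
  assumes bridge: "\<And>a b. (a, b) \<in> parcs G \<Longrightarrow> (a, b) \<notin> (deleted G a b)\<^sup>*"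
  shows "undirected_tree G"
proof -
  have False if p: "cycle p" "3 \<le> length p" for p
  proof -
    obtain u where u: "awalk u p u" "distinct (tl (awalk_verts u p))"
      using p(1) by (auto simp: cycle_def)
    obtain e r where pe: "p = e # r" using p(2) by (cases p) auto
    define b where "b = snd e"
    have e: "e = (u, b)" "(u, b) \<in> parcs G" "awalk b r u"
      using u(1) by (auto simp: pe b_def awalk_Cons_iff)
    then have path: "apath b r u" using u(2) by (simp add: pe apath_def)
    obtain x r' where r: "r = (b, x) # r'" using p(2) e(3) by (cases r) (auto simp: pe awalk_Cons_iff)
    have path': "apath x r' u" "b \<notin> set (awalk_verts x r')"
      using path by (auto simp: r apath_Cons_iff)
    \<comment> \<open>Here the length 3 enters: it excludes the closed walk \<open>u\<close>,
      \<open>b\<close>, \<open>u\<close>.\<close>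
    have "x \<noteq> u"
    proof
      assume "x = u"
      then have "r' = []" using path'(1) apath_nonempty_ends by blast
      then show False using p(2) by (simp add: pe r)
    qed
    have "(b, u) \<notin> set r"
      using \<open>x \<noteq> u\<close> path'(2) awalk_verts_arc1[of "(b, u)" r' x] by (auto simp: r)
    moreover have "(u, b) \<notin> set r"
    proof
      assume "(u, b) \<in> set r"
      moreover have "u \<noteq> b" using e(2) no_loops' by blast
      ultimately have "(u, b) \<in> set r'" by (auto simp: r)
      then show False using path' awalk_verts_arc2[of x r' u "(u, b)"] by (auto simp: apath_def)
    qed
    ultimately have "set r \<subseteq> deleted G b u" using e(3) by auto
    then have "(b, u) \<in> (deleted G b u)\<^sup>*" by (rule awalk_imp_rtrancl[OF e(3)])
    then show False using bridge[OF arcs_symmetric[OF e(2)]] by blast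
  qed
  then show ?thesis using connected pair_graph unfolding undirected_tree_def by blast
qed

locale tree_graph = connected_graph +
  assumes bridge: "(a, b) \<in> parcs G \<Longrightarrow> (a, b) \<notin> (deleted G a b)\<^sup>*"
begin

lemma deleted_sym: "(x, y) \<in> (deleted G a b)\<^sup>* \<Longrightarrow> (y, x) \<in> (deleted G a b)\<^sup>*"
proof -
  have "sym (deleted G a b)" using arcs_symmetric by (auto intro!: symI)
  then show "(x, y) \<in> (deleted G a b)\<^sup>* \<Longrightarrow> (y, x) \<in> (deleted G a b)\<^sup>*"
    using sym_rtrancl symD by fast
qed

lemma deleted_swap: "deleted G a b = deleted G b a"
  by blast

lemma two_components:
  assumes pq: "(p, q) \<in> parcs G" and x: "x \<in> pverts G"
  shows "(p, x) \<in> (deleted G p q)\<^sup>* \<or> (q, x) \<in> (deleted G p q)\<^sup>*"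
proof -
  have "(p, x) \<in> (parcs G)\<^sup>*"
    using walk_exists[OF in_arcsD1[OF pq] x] by (simp add: rtrancl_power)
  then show ?thesis
  proof (induction rule: rtrancl_induct)
    case (step y z)
    show ?case
    proof (cases "(y, z) \<in> deleted G p q")
      case True then show ?thesis using step.IH by (meson rtrancl.rtrancl_into_rtrancl)
    next
      case False
      then have "z = p \<or> z = q" using step.hyps(2) by blast
      then show ?thesis by blast
    qed
  qed simp
qed

lemma components_disjoint:
  assumes "(p, q) \<in> parcs G" "(p, x) \<in> (deleted G p q)\<^sup>*"
  shows "(q, x) \<notin> (deleted G p q)\<^sup>*"
  using bridge[OF assms(1)] assms(2) deleted_sym rtrancl_trans by metis

text \<open>A walk from \<open>q\<close> to \<open>x\<close> must enter the component of
  \<open>p\<close> through the deleted edge; its remainder starts at \<open>p\<close> and is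
  strictly shorter.\<close>

lemma closer_in_component:
  assumes pq: "(p, q) \<in> parcs G" and x: "(p, x) \<in> (deleted G p q)\<^sup>*" "x \<in> pverts G"
  shows "d p x < d q x"
proof -
  have "\<exists>m<n. (p, x) \<in> parcs G ^^ m"
    if "(q, y) \<in> (deleted G p q)\<^sup>*" "(y, x) \<in> parcs G ^^ n" for n y
    using that
  proof (induction n arbitrary: y)
    case 0
    then show ?case using components_disjoint[OF pq x(1)] by auto
  next
    case (Suc n)
    then obtain z where z: "(y, z) \<in> parcs G" "(z, x) \<in> parcs G ^^ n" by (meson relpow_Suc_D2)
    show ?case
    proof (cases "(y, z) \<in> deleted G p q")
      case True
      then have "(q, z) \<in> (deleted G p q)\<^sup>*" using Suc.prems(1) by (meson rtrancl.rtrancl_into_rtrancl)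
      then show ?thesis using Suc.IH z(2) less_SucI by blast
    next
      case False
      have "y \<noteq> p" using Suc.prems(1) components_disjoint[OF pq, of p] by auto
      then have "z = p" using False z(1) by blast
      then show ?thesis using z(2) by blast
    qed
  qed
  from this[OF rtrancl_refl walk_d[OF in_arcsD2[OF pq] x(2)]] obtain m
    where "m < d q x" "(p, x) \<in> parcs G ^^ m" by blast
  then show ?thesis using d_le[OF in_arcsD1[OF pq]] by (meson le_less_trans)
qed

lemma closer_iff:
  assumes pq: "(p, q) \<in> parcs G" and x: "x \<in> pverts G"
  shows "d p x < d q x \<longleftrightarrow> (p, x) \<in> (deleted G p q)\<^sup>*"
    and "d q x < d p x \<longleftrightarrow> (q, x) \<in> (deleted G p q)\<^sup>*"
proof -
  have 1: "(p, x) \<in> (deleted G p q)\<^sup>* \<Longrightarrow> d p x < d q x"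
    using closer_in_component[OF pq _ x] .
  have 2: "(q, x) \<in> (deleted G p q)\<^sup>* \<Longrightarrow> d q x < d p x"
    using closer_in_component[OF arcs_symmetric[OF pq] _ x] deleted_swap[of p q] by simp
  show "d p x < d q x \<longleftrightarrow> (p, x) \<in> (deleted G p q)\<^sup>*"
    and "d q x < d p x \<longleftrightarrow> (q, x) \<in> (deleted G p q)\<^sup>*"
    using 1 2 two_components[OF pq x] by linarith+
qed

text \<open>The component of \<open>q\<close> contains neither \<open>r\<close> nor
  \<open>s\<close>, so all its edges survive the deletion of \<open>rs\<close>.\<close>

lemma component_avoids:
  assumes pq: "(p, q) \<in> parcs G" and rs: "(r, s) \<in> parcs G"
    and r: "(p, r) \<in> (deleted G p q)\<^sup>*" and s: "(p, s) \<in> (deleted G p q)\<^sup>*"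
    and x: "(q, x) \<in> (deleted G p q)\<^sup>*"
  shows "(q, x) \<in> (deleted G r s)\<^sup>*"
  using x
proof (induction rule: rtrancl_induct)
  case (step y z)
  have "y \<noteq> r" "y \<noteq> s" using components_disjoint[OF pq r] components_disjoint[OF pq s] step.hyps(1) by auto
  then have "(y, z) \<in> deleted G r s" using step.hyps(2) by blast
  with step.IH show ?case by (meson rtrancl.rtrancl_into_rtrancl)
qed simp

text \<open>Orient \<open>pq\<close> so that \<open>rs\<close> lies on the side of
  \<open>p'\<close>. The half of \<open>q'\<close> stays connected without \<open>rs\<close>, so it
  lies in one half of \<open>rs\<close> and misses the other.\<close>

lemma halves_crossing:
  assumes pq: "(p, q) \<in> parcs G" and rs: "(r, s) \<in> parcs G"
    and ne: "\<And>a b c e. (a, b) \<in> {(p, q), (q, p)} \<Longrightarrow> (c, e) \<in> {(r, s), (s, r)} \<Longrightarrow>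
      \<exists>x\<in>pverts G. d a x < d b x \<and> d c x < d e x"
  shows "{p, q} = {r, s}"
proof (rule ccontr)
  assume neq: "{p, q} \<noteq> {r, s}"
  have *: False if pq: "(p', q') \<in> {(p, q), (q, p)}" and r: "(p', r) \<in> (deleted G p' q')\<^sup>*" for p' q'
  proof -
    have pq': "(p', q') \<in> parcs G" using pq assms(1) arcs_symmetric by blast
    have "(r, s) \<in> deleted G p' q'" using neq pq rs by auto
    then have s: "(p', s) \<in> (deleted G p' q')\<^sup>*" using r by (meson rtrancl.rtrancl_into_rtrancl)
    have q': "q' \<in> pverts G" using in_arcsD2[OF pq'] .
    have qp: "(q', p') \<in> {(p, q), (q, p)}" using pq by auto
    have mem: "(q', x) \<in> (deleted G r s)\<^sup>*" if "x \<in> pverts G" "d q' x < d p' x" for x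
      using closer_iff(2)[OF pq' that(1)] that(2) component_avoids[OF pq' rs r s, of x] by simp
    obtain x where x: "x \<in> pverts G" "d q' x < d p' x" "d r x < d s x" using ne[OF qp, of r s] by blast
    obtain y where y: "y \<in> pverts G" "d q' y < d p' y" "d s y < d r y" using ne[OF qp, of s r] by blast
    have "(r, x) \<in> (deleted G r s)\<^sup>*" using closer_iff(1)[OF rs x(1)] x(3) by simp
    moreover have "(s, y) \<in> (deleted G r s)\<^sup>*"
      using closer_iff(2)[OF rs y(1)] y(3) by simp
    ultimately have "(r, q') \<in> (deleted G r s)\<^sup>*" "(s, q') \<in> (deleted G r s)\<^sup>*"
      using deleted_sym[OF mem[OF x(1,2)]] deleted_sym[OF mem[OF y(1,2)]] by (meson rtrancl_trans)+
    then show False using components_disjoint[OF rs] by blast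
  qed
  consider "(p, r) \<in> (deleted G p q)\<^sup>*" | "(q, r) \<in> (deleted G q p)\<^sup>*"
    using two_components[OF pq in_arcsD1[OF rs]] deleted_swap[of p q] by auto
  then show False using *[of p q] *[of q p] by cases auto
qed

end

lemma undirected_tree_tree_graph:
  assumes "undirected_tree T"
  shows "tree_graph T"
proof (rule tree_graph.intro)
  show "connected_graph T"
    using assms by (simp add: undirected_tree_def connected_graph_def connected_graph_axioms_def)
  show "tree_graph_axioms T"
    using undirected_tree_bridge[OF assms] by unfold_locales
qed

section \<open>Products of trees and colourings\<close>

lemma cartesian_product_verts:
  "xs \<in> pverts (cartesian_product Ts) \<longleftrightarrow> length xs = length Ts \<and> (\<forall>i<length Ts. xs ! i \<in> pverts (Ts ! i))"
  by (simp add: cartesian_product_def)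

lemma cartesian_product_arcs:
  "(xs, ys) \<in> parcs (cartesian_product Ts) \<longleftrightarrow>
    xs \<in> pverts (cartesian_product Ts) \<and> ys \<in> pverts (cartesian_product Ts) \<and>
    (\<exists>i<length Ts. (xs ! i, ys ! i) \<in> parcs (Ts ! i) \<and> (\<forall>j<length Ts. j \<noteq> i \<longrightarrow> xs ! j = ys ! j))"
  by (simp add: cartesian_product_def Let_def)

lemma gdist_cartesian_product:
  assumes Ts: "\<And>T. T \<in> set Ts \<Longrightarrow> connected_graph T"
    and xs: "xs \<in> pverts (cartesian_product Ts)" and ys: "ys \<in> pverts (cartesian_product Ts)"
  shows "gdist (cartesian_product Ts) xs ys = (\<Sum>i<length Ts. gdist (Ts ! i) (xs ! i) (ys ! i))"
proof (rule gdist_eqI(1)[OF _ xs])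
  have T: "connected_graph (Ts ! i)" if "i < length Ts" for i using Ts that by simp
  show "pair_wf_digraph (cartesian_product Ts)"
    by unfold_locales (auto simp: cartesian_product_arcs)
  show "(\<Sum>i<length Ts. gdist (Ts ! i) (zs ! i) (ys ! i)) = 0 \<longleftrightarrow> zs = ys"
    if "zs \<in> pverts (cartesian_product Ts)" for zs
  proof -
    have "gdist (Ts ! i) (zs ! i) (ys ! i) = 0 \<longleftrightarrow> zs ! i = ys ! i" if "i < length Ts" for i
      using connected_graph.d_eq_0[OF T[OF that]] that ys \<open>zs \<in> _\<close> by (simp add: cartesian_product_verts)
    then show ?thesis
      using that ys by (auto simp: cartesian_product_verts list_eq_iff_nth_eq)
  qed
  show "(\<Sum>i<length Ts. gdist (Ts ! i) (zs ! i) (ys ! i)) \<le> (\<Sum>i<length Ts. gdist (Ts ! i) (zs' ! i) (ys ! i)) + 1"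
    if zs: "(zs, zs') \<in> parcs (cartesian_product Ts)" for zs zs'
  proof -
    obtain i where i: "i < length Ts" "(zs ! i, zs' ! i) \<in> parcs (Ts ! i)"
      "\<And>j. j < length Ts \<Longrightarrow> j \<noteq> i \<Longrightarrow> zs ! j = zs' ! j"
      using zs by (auto simp: cartesian_product_arcs)
    have "gdist (Ts ! i) (zs ! i) (ys ! i) \<le> gdist (Ts ! i) (zs' ! i) (ys ! i) + 1"
      using connected_graph.d_lipschitz(1)[OF T[OF i(1)] i(2)] ys i(1) by (simp add: cartesian_product_verts)
    then show ?thesis
      using i(1,3) by (simp add: sum.remove[of "{..<length Ts}" i])
  qed
  show "\<exists>zs'. (zs, zs') \<in> parcs (cartesian_product Ts) \<and>
      (\<Sum>i<length Ts. gdist (Ts ! i) (zs' ! i) (ys ! i)) < (\<Sum>i<length Ts. gdist (Ts ! i) (zs ! i) (ys ! i))"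
    if zs: "zs \<in> pverts (cartesian_product Ts)" "0 < (\<Sum>i<length Ts. gdist (Ts ! i) (zs ! i) (ys ! i))" for zs
  proof -
    obtain i where i: "i < length Ts" "gdist (Ts ! i) (zs ! i) (ys ! i) \<noteq> 0"
      using zs(2) by (metis (mono_tags, lifting) lessThan_iff not_less_zero sum.neutral)
    interpret connected_graph "Ts ! i" using T[OF i(1)] .
    have V: "zs ! i \<in> pverts (Ts ! i)" "ys ! i \<in> pverts (Ts ! i)" "zs ! i \<noteq> ys ! i"
      using zs(1) ys i d_eq_0 by (auto simp: cartesian_product_verts)
    obtain w where w: "(zs ! i, w) \<in> parcs (Ts ! i)" "d (zs ! i) (ys ! i) = d w (ys ! i) + 1"
      using d_next[OF V] by blast
    have len: "length zs = length Ts" using zs(1) by (simp add: cartesian_product_verts)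
    have "(zs, zs[i := w]) \<in> parcs (cartesian_product Ts)"
      using zs(1) i(1) w(1) in_arcsD2[OF w(1)] len
      by (auto simp: cartesian_product_arcs cartesian_product_verts nth_list_update)
    moreover have "(\<Sum>j<length Ts. gdist (Ts ! j) (zs[i := w] ! j) (ys ! j)) < (\<Sum>j<length Ts. gdist (Ts ! j) (zs ! j) (ys ! j))"
      using i(1) w(2) len by (intro sum_strict_mono_ex1) (auto simp: nth_list_update)
    ultimately show ?thesis by blast
  qed
qed

section \<open>The tree of one colour\<close>

context coloured_cube begin

definition proj :: "nat \<Rightarrow> 'a \<Rightarrow> 'i set" where
  "proj c a = {E \<in> h a. col E = c}"

text \<open>The definition of \<open>tdim\<close> asks for trees on natural numbers; any injective
  numbering of the finite cube serves.\<close>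

definition enc :: "'i set \<Rightarrow> nat" where
  "enc = (SOME f. inj_on f (Pow I))"

definition code :: "nat \<Rightarrow> 'a \<Rightarrow> nat" where
  "code c a = enc (proj c a)"

text \<open>The quotient that identifies vertices with the same classes of colour \<open>c\<close>.
  It is acyclic because classes of one colour do not cross.\<close>

definition cube_tree :: "nat \<Rightarrow> nat pair_pre_digraph" where
  "cube_tree c = \<lparr>pverts = code c ` V,
    parcs = {(code c a, code c b) | a b. a \<in> V \<and> b \<in> V \<and> (\<exists>E. proj c b = flip E (proj c a))}\<rparr>"

lemma inj_enc: "inj_on enc (Pow I)"
proof -
  have "\<exists>f :: 'i set \<Rightarrow> nat. inj_on f (Pow I)"
    using finite_imp_inj_to_nat_seg[of "Pow I"] finite_I by blast
  then show ?thesis unfolding enc_def by (rule someI_ex)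
qed

lemma proj_subset: "a \<in> V \<Longrightarrow> proj c a \<in> Pow I"
  using h_subset by (auto simp: proj_def)

lemma in_proj [simp]: "E \<in> proj c a \<longleftrightarrow> E \<in> h a \<and> col E = c"
  by (simp add: proj_def)

lemma code_eq: "a \<in> V \<Longrightarrow> b \<in> V \<Longrightarrow> code c a = code c b \<longleftrightarrow> proj c a = proj c b"
  unfolding code_def by (rule inj_on_eq_iff[OF inj_enc proj_subset proj_subset])

lemma cube_tree_arc:
  assumes "a \<in> V" "b \<in> V"
  shows "(code c a, code c b) \<in> parcs (cube_tree c) \<longleftrightarrow> (\<exists>E. proj c b = flip E (proj c a))"
proof
  assume "(code c a, code c b) \<in> parcs (cube_tree c)"
  then obtain a' b' E where "a' \<in> V" "b' \<in> V" "code c a = code c a'" "code c b = code c b'"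
    "proj c b' = flip E (proj c a')" by (auto simp: cube_tree_def)
  then show "\<exists>E. proj c b = flip E (proj c a)" using assms code_eq by metis
qed (use assms in \<open>auto simp: cube_tree_def\<close>)

lemma cube_tree_arcE:
  assumes "(x, y) \<in> parcs (cube_tree c)"
  obtains a b E where "a \<in> V" "b \<in> V" "x = code c a" "y = code c b" "proj c b = flip E (proj c a)"
  using assms by (auto simp: cube_tree_def)

lemma proj_flip:
  assumes "a \<in> V" "b \<in> V" "proj c b = flip E (proj c a)"
  shows "E \<in> I" "col E = c" "(E \<in> h a) \<noteq> (E \<in> h b)"
proof -
  have *: "E \<in> proj c b \<longleftrightarrow> E \<notin> proj c a" unfolding assms(3) by simp
  then show "E \<in> I" "col E = c" using proj_subset[OF assms(1), of c] proj_subset[OF assms(2), of c] by auto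
  with * show "(E \<in> h a) \<noteq> (E \<in> h b)" by auto
qed

lemma pair_graph_cube_tree: "pair_graph (cube_tree c)"
proof
  have fin: "finite (pverts (cube_tree c))" using finite_V by (simp add: cube_tree_def)
  have sub: "parcs (cube_tree c) \<subseteq> pverts (cube_tree c) \<times> pverts (cube_tree c)"
    by (auto simp: cube_tree_def)
  show "finite (pverts (cube_tree c))" by (rule fin)
  show "finite (parcs (cube_tree c))" using finite_subset[OF sub] fin by simp
  show "fst e \<in> pverts (cube_tree c)" "snd e \<in> pverts (cube_tree c)" if "e \<in> parcs (cube_tree c)" for e
    using that sub by auto
  show "fst e \<noteq> snd e" if e: "e \<in> parcs (cube_tree c)" for e
  proof
    assume eq: "fst e = snd e"
    obtain a b E where ab: "a \<in> V" "b \<in> V" "fst e = code c a" "snd e = code c b" "proj c b = flip E (proj c a)"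
      using cube_tree_arcE[of "fst e" "snd e" c] e by auto
    then have "proj c a = proj c b" using eq code_eq by simp
    then show False using proj_flip[OF ab(1,2,5)] by (auto simp: set_eq_iff)
  qed
  show "symmetric (with_proj (cube_tree c))"
    unfolding symmetric_def with_proj_simps
  proof (rule symI)
    fix x y assume "(x, y) \<in> parcs (cube_tree c)"
    then obtain a b E where ab: "a \<in> V" "b \<in> V" "x = code c a" "y = code c b" "proj c b = flip E (proj c a)"
      by (rule cube_tree_arcE)
    have "proj c a = flip E (proj c b)" unfolding ab(5) by simp
    then show "(y, x) \<in> parcs (cube_tree c)" using ab(1-4) cube_tree_arc by blast
  qed
qed

lemma finite_proj: "a \<in> V \<Longrightarrow> finite (proj c a)"
  by (simp add: proj_def)

text \<open>The criterion is applied to the number of separating classes of colour \<open>c\<close>;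
  the descent is \<open>approach\<close> for a virtual cop standing at \<open>h x\<close>. The
  second conclusion is for connectedness.\<close>

lemma cube_tree_dist:
  assumes a: "a \<in> V" and b: "b \<in> V"
  shows "gdist (cube_tree c) (code c a) (code c b) = card (delta (proj c a) (proj c b))"
    and "\<exists>n. (code c a, code c b) \<in> parcs (cube_tree c) ^^ n"
proof -
  interpret T: pair_graph "cube_tree c" by (rule pair_graph_cube_tree)
  \<comment> \<open>The criterion needs a function on the coded vertices, hence the
    decoding.\<close>
  define D where "D n = card (delta (inv_into (Pow I) enc n) (proj c b))" for n
  have D: "D (code c x) = card (delta (proj c x) (proj c b))" if "x \<in> V" for x
    unfolding D_def code_def using inv_into_f_f[OF inj_enc proj_subset[OF that]] by simp
  have verts: "\<exists>x\<in>V. n = code c x" if "n \<in> pverts (cube_tree c)" for n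
    using that by (auto simp: cube_tree_def)
  have zero: "D n = 0 \<longleftrightarrow> n = code c b" if "n \<in> pverts (cube_tree c)" for n
    using verts[OF that] D code_eq b finite_proj by auto
  have lip: "D n \<le> D n' + 1" if nn': "(n, n') \<in> parcs (cube_tree c)" for n n'
  proof -
    obtain x y E where xy: "x \<in> V" "y \<in> V" "n = code c x" "n' = code c y" "proj c y = flip E (proj c x)"
      using nn' by (rule cube_tree_arcE)
    have "delta (proj c x) (proj c b) \<subseteq> insert E (delta (proj c y) (proj c b))"
      unfolding xy(5) by auto
    then have "card (delta (proj c x) (proj c b)) \<le> card (insert E (delta (proj c y) (proj c b)))"
      using xy(2) b finite_proj by (intro card_mono) auto
    also have "\<dots> \<le> card (delta (proj c y) (proj c b)) + 1"
      using card_insert_le_m1 by (simp add: card_insert_if xy(2) b finite_proj)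
    finally show ?thesis using D xy(1-4) by simp
  qed
  have descend: "\<exists>n'. (n, n') \<in> parcs (cube_tree c) \<and> D n' < D n"
    if n: "n \<in> pverts (cube_tree c)" "D n > 0" for n
  proof -
    obtain x where x: "x \<in> V" "n = code c x" using verts[OF n(1)] by blast
    then have "card (delta (proj c x) (proj c b)) \<noteq> 0" using n(2) D by simp
    then obtain F where "F \<in> delta (proj c x) (proj c b)" by (metis card.empty equals0I)
    then have F: "F \<in> delta (h x) (h b)" "col F = c" by auto
    obtain E where E: "E \<in> delta (h x) (h b)" "col E = c" "realised (flip E (h x))"
      using approach[OF realised_h[OF x(1)] b F(1)] F(2) by blast
    then obtain y where y: "y \<in> V" "\<forall>E'\<in>I. col E' = c \<longrightarrow> (E' \<in> flip E (h x) \<longleftrightarrow> E' \<in> h y)"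
      unfolding realised_def by blast
    have fl: "flip E (h x) \<subseteq> I" using E(3) realised_subset by blast
    have projy: "proj c y = flip E (proj c x)"
    proof (rule set_eqI)
      show "E' \<in> proj c y \<longleftrightarrow> E' \<in> flip E (proj c x)" for E'
      proof (cases "E' \<in> I \<and> col E' = c")
        case True
        then show ?thesis using y(2) by auto
      next
        case False
        then show ?thesis using h_subset[OF y(1)] h_subset[OF x(1)] fl E(1,2) h_subset[OF b] by auto
      qed
    qed
    have "delta (proj c y) (proj c b) = delta (proj c x) (proj c b) - {E}"
      unfolding projy using E(1,2) by auto
    moreover have "E \<in> delta (proj c x) (proj c b)" using E(1,2) by auto
    ultimately have "D (code c y) < D n"
      using D x y(1) b finite_proj by (metis card_Diff1_less finite_delta)
    then show ?thesis using cube_tree_arc[OF x(1) y(1)] projy x(2) by blast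
  qed
  have av: "code c a \<in> pverts (cube_tree c)" using a by (simp add: cube_tree_def)
  show "gdist (cube_tree c) (code c a) (code c b) = card (delta (proj c a) (proj c b))"
    using gdist_eqI(1)[of "cube_tree c" "code c a" D "code c b", OF T.pair_wf_digraph av zero lip descend] D[OF a]
    by simp
  show "\<exists>n. (code c a, code c b) \<in> parcs (cube_tree c) ^^ n"
    using gdist_eqI(2)[of "cube_tree c" "code c a" D "code c b", OF T.pair_wf_digraph av zero lip descend] by blast
qed

lemma connected_cube_tree: "connected_graph (cube_tree c)"
proof -
  interpret T: pair_graph "cube_tree c" by (rule pair_graph_cube_tree)
  have "connected (with_proj (cube_tree c))"
    using cube_tree_dist(2) V_nonempty
    by (intro connectedI[OF pair_graph_cube_tree]) (auto simp: cube_tree_def)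
  then show ?thesis by unfold_locales
qed

text \<open>
  An edge of the tree that flips the same class as \<open>xy\<close> is \<open>xy\<close> itself, as otherwise two classes
  of colour \<open>c\<close> cross.
\<close>

lemma undirected_tree_cube_tree: "undirected_tree (cube_tree c)"
proof -
  interpret T: connected_graph "cube_tree c" by (rule connected_cube_tree)
  show ?thesis
  proof (rule T.undirected_treeI)
    fix x y assume "(x, y) \<in> parcs (cube_tree c)"
    then obtain a b E where ab: "a \<in> V" "b \<in> V" "x = code c a" "y = code c b" "proj c b = flip E (proj c a)"
      by (rule cube_tree_arcE)
    note E = proj_flip[OF ab(1,2,5)]
    have key: "\<exists>m\<in>V. z = code c m \<and> (E \<in> h m) = (E \<in> h a)"
      if "(x, z) \<in> (deleted (cube_tree c) x y)\<^sup>*" for z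
      using that
    proof (induction rule: rtrancl_induct)
      case base
      then show ?case using ab by blast
    next
      case (step z w)
      obtain m where m: "m \<in> V" "z = code c m" "(E \<in> h m) = (E \<in> h a)" using step.IH by blast
      obtain m' n E' where n: "m' \<in> V" "n \<in> V" "z = code c m'" "w = code c n" "proj c n = flip E' (proj c m')"
        using step.hyps(2) cube_tree_arcE[of z w c] by blast
      have n5: "proj c n = flip E' (proj c m)" using n code_eq m by metis
      show ?case
      proof (cases "(E \<in> h n) = (E \<in> h a)")
        case True
        then show ?thesis using n by blast
      next
        case False
        have "E \<in> proj c n \<longleftrightarrow> E \<notin> proj c m" using False m(3) E(2) by auto
        then have "E' = E" unfolding n5 by auto
        have "proj c m = proj c a"
        proof (rule ccontr)
          assume "proj c m \<noteq> proj c a"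
          then obtain F where F: "(F \<in> proj c m) \<noteq> (F \<in> proj c a)" by blast
          then have F2: "col F = c" "(F \<in> h m) \<noteq> (F \<in> h a)" "F \<in> I"
            using proj_subset[OF m(1), of c] proj_subset[OF ab(1), of c] by auto
          have "F \<noteq> E" using F2(2) m(3) by blast
          have Fb: "(F \<in> h b) = (F \<in> h a)"
          proof -
            have "F \<in> proj c b \<longleftrightarrow> F \<in> proj c a" unfolding ab(5) using \<open>F \<noteq> E\<close> by simp
            then show ?thesis using F2(1) by simp
          qed
          have Fn: "(F \<in> h n) = (F \<in> h m)"
          proof -
            have "F \<in> proj c n \<longleftrightarrow> F \<in> proj c m" unfolding n5 \<open>E' = E\<close> using \<open>F \<noteq> E\<close> by simp
            then show ?thesis using F2(1) by simp
          qed
          have 1: "\<exists>v\<in>V. (E \<in> h v) = (E \<in> h a) \<and> (F \<in> h v) = (F \<in> h a)" using ab(1) by blast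
          have 2: "\<exists>v\<in>V. (E \<in> h v) \<noteq> (E \<in> h a) \<and> (F \<in> h v) = (F \<in> h a)" using ab(2) E(3) Fb by blast
          have 3: "\<exists>v\<in>V. (E \<in> h v) = (E \<in> h a) \<and> (F \<in> h v) \<noteq> (F \<in> h a)" using m(1,3) F2(2) by blast
          have 4: "\<exists>v\<in>V. (E \<in> h v) \<noteq> (E \<in> h a) \<and> (F \<in> h v) \<noteq> (F \<in> h a)" using n(2) False Fn F2(2) by blast
          have "E = F"
          proof (rule four_patterns[OF E(1) F2(3)])
            show "col E = col F" using E(2) F2(1) by simp
            show "\<exists>v\<in>V. (E \<in> h v) = e \<and> (F \<in> h v) = f" for e f
              using 1 2 3 4 by (cases "e = (E \<in> h a)"; cases "f = (F \<in> h a)") simp_all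
          qed
          with \<open>F \<noteq> E\<close> show False by simp
        qed
        then have "z = x" "w = y"
          using m(1,2) n(2,4) n5 \<open>E' = E\<close> ab code_eq by metis+
        then show ?thesis using step.hyps(2) by blast
      qed
    qed
    have False if "m \<in> V" "y = code c m" "(E \<in> h m) = (E \<in> h a)" for m
    proof -
      have "proj c m = proj c b" using that(1,2) ab(2,4) code_eq by simp
      then have "E \<in> proj c m \<longleftrightarrow> E \<in> proj c b" by simp
      then show False using that(3) E(2,3) by simp
    qed
    then show "(x, y) \<notin> (deleted (cube_tree c) x y)\<^sup>*" using key by blast
  qed
qed

lemma card_delta_colours:
  assumes "\<And>E. E \<in> I \<Longrightarrow> col E < t" "a \<in> V" "b \<in> V"
  shows "card (delta (h a) (h b)) = (\<Sum>c<t. card (delta (proj c a) (proj c b)))"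
proof -
  have "delta (h a) (h b) = (\<Union>c<t. delta (proj c a) (proj c b))"
    using assms(1) h_subset[OF assms(2)] h_subset[OF assms(3)] by fastforce
  also have "card \<dots> = (\<Sum>c<t. card (delta (proj c a) (proj c b)))"
    using finite_proj[OF assms(2)] finite_proj[OF assms(3)]
    by (intro card_UN_disjoint) auto
  finally show ?thesis .
qed

end

section \<open>Colourings and isometric embeddings into products of trees\<close>

context median begin

lemma cross_irrefl: "E \<in> Theta_classes G \<Longrightarrow> \<not> cross G E E"
  using cross_iff[of E E] by blast

text \<open>A distance counts separating classes; sorting them by colour gives the sum of the
  distances in the trees.\<close>

lemma colouring_imp_embedding:
  assumes c: "proper_colouring (crossing_graph G) t c"
  obtains Ts :: "nat pair_pre_digraph list" and f where "length Ts = t" "\<forall>T\<in>set Ts. undirected_tree T"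
    "isometric_embedding f G (cartesian_product Ts)"
proof -
  interpret cc: coloured_cube "pverts G" "Theta_classes G" hc c
    by (rule coloured_cubeI[OF c])
  define Ts where "Ts = map cc.cube_tree [0..<t]"
  define f where "f a = map (\<lambda>i. cc.code i a) [0..<t]" for a
  have col: "c E < t" if "E \<in> Theta_classes G" for E
    using c that by (auto simp: proper_colouring_def crossing_graph_def)
  have trees: "\<forall>T\<in>set Ts. undirected_tree T" by (auto simp: Ts_def cc.undirected_tree_cube_tree)
  have f_in: "f a \<in> pverts (cartesian_product Ts)" if "a \<in> pverts G" for a
    using that by (simp add: cartesian_product_verts f_def Ts_def cc.cube_tree_def)
  have "gdist (cartesian_product Ts) (f u) (f v) = d u v" if uv: "u \<in> pverts G" "v \<in> pverts G" for u v
  proof -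
    have "gdist (cartesian_product Ts) (f u) (f v) = (\<Sum>i<length Ts. gdist (Ts ! i) (f u ! i) (f v ! i))"
      using f_in uv by (intro gdist_cartesian_product) (auto simp: Ts_def cc.connected_cube_tree)
    also have "\<dots> = (\<Sum>i<t. card (delta (cc.proj i u) (cc.proj i v)))"
      using cc.cube_tree_dist(1)[OF uv] by (intro sum.cong) (auto simp: Ts_def f_def)
    also have "\<dots> = d u v"
      using cc.card_delta_colours[OF col uv] d_eq_card[OF uv] by simp
    finally show ?thesis .
  qed
  then have "isometric_embedding f G (cartesian_product Ts)"
    using f_in by (auto simp: isometric_embedding_def)
  with that[of Ts f] trees show thesis by (simp add: Ts_def)
qed

text \<open>Every edge of \<open>G\<close> moves in exactly one factor, and the index of this factor
  colours its class. Semicubes are then preimages of halves of a tree, where two different edges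
  never have all four pairs of halves meeting.\<close>

lemma embedding_imp_colouring:
  assumes trees: "\<forall>T\<in>set Ts. undirected_tree T"
    and f: "isometric_embedding f G (cartesian_product Ts)"
  obtains c where "proper_colouring (crossing_graph G) (length Ts) c"
proof -
  define t where "t = length Ts"
  define D where "D i a b = gdist (Ts ! i) (f a ! i) (f b ! i)" for i a b
  have T: "tree_graph (Ts ! i)" if "i < t" for i
    using trees that nth_mem[of i Ts] by (intro undirected_tree_tree_graph) (auto simp: t_def)
  have fV: "f a \<in> pverts (cartesian_product Ts)" if "a \<in> pverts G" for a
    using f that by (auto simp: isometric_embedding_def)
  have fi: "f a ! i \<in> pverts (Ts ! i)" if "a \<in> pverts G" "i < t" for a i
    using fV[OF that(1)] that(2) by (simp add: cartesian_product_verts t_def)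
  have dsum: "d a b = (\<Sum>i<t. D i a b)" if "a \<in> pverts G" "b \<in> pverts G" for a b
  proof -
    have "connected_graph T" if "T \<in> set Ts" for T
      using trees that undirected_tree_tree_graph tree_graph.axioms(1) by blast
    then show ?thesis
      using f that gdist_cartesian_product[of Ts "f a" "f b"] fV
      by (simp add: isometric_embedding_def D_def t_def)
  qed
  define along where "along i u v \<longleftrightarrow> i < t \<and> (u, v) \<in> parcs G \<and> (f u ! i, f v ! i) \<in> parcs (Ts ! i) \<and>
    (\<forall>j<t. j \<noteq> i \<longrightarrow> f u ! j = f v ! j)" for i u v
  have along_exists: "\<exists>i. along i u v" if uv: "(u, v) \<in> parcs G" for u v
  proof -
    have V: "u \<in> pverts G" "v \<in> pverts G" using wellformed'[OF uv] .
    \<comment> \<open>Natural numbers with sum 1: one summand is 1 and the others vanish.\<close>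
    have sum1: "(\<Sum>i<t. D i u v) = 1" using dsum[OF V] d_arc[OF uv] by simp
    then obtain i where i: "i < t" "D i u v \<noteq> 0"
      by (metis lessThan_iff sum.neutral zero_neq_one)
    have "D i u v + (\<Sum>j\<in>{..<t} - {i}. D j u v) = 1"
      using sum1 i(1) by (simp add: sum.remove[of "{..<t}" i])
    then have "D i u v = 1" "(\<Sum>j\<in>{..<t} - {i}. D j u v) = 0" using i(2) by linarith+
    then have 1: "gdist (Ts ! i) (f u ! i) (f v ! i) = 1"
      and 0: "\<forall>j\<in>{..<t} - {i}. gdist (Ts ! j) (f u ! j) (f v ! j) = 0" by (auto simp: D_def)
    have "(f u ! i, f v ! i) \<in> parcs (Ts ! i)"
      using connected_graph.d_arc_iff[OF tree_graph.axioms(1)[OF T[OF i(1)]] fi[OF V(1) i(1)] fi[OF V(2) i(1)]] 1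
      by simp
    moreover have "f u ! j = f v ! j" if "j < t" "j \<noteq> i" for j
      using connected_graph.d_eq_0[OF tree_graph.axioms(1)[OF T[OF that(1)]] fi[OF V(1) that(1)] fi[OF V(2) that(1)]]
        0 that by simp
    ultimately show ?thesis using i(1) uv by (auto simp: along_def)
  qed
  have along_sym: "along i v u" if "along i u v" for i u v
  proof -
    have "i < t" using that by (simp add: along_def)
    then interpret T: tree_graph "Ts ! i" by (rule T)
    show ?thesis using that arcs_symmetric T.arcs_symmetric by (simp add: along_def)
  qed
  have W_along: "a \<in> W u v \<longleftrightarrow> D i u a < D i v a" if "along i u v" "a \<in> pverts G" for i u v a
  proof -
    have i: "i < t" "(u, v) \<in> parcs G" using that(1) by (auto simp: along_def)
    \<comment> \<open>The other factors contribute equally to both distances and cancel.\<close>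
    have "(\<Sum>j\<in>{..<t} - {i}. D j u a) = (\<Sum>j\<in>{..<t} - {i}. D j v a)"
      using that(1) by (intro sum.cong) (auto simp: along_def D_def)
    then show ?thesis
      using i(1) dsum[OF wellformed'(1)[OF i(2)] that(2)] dsum[OF wellformed'(2)[OF i(2)] that(2)] that(2)
      by (simp add: in_W_iff sum.remove[of "{..<t}" i])
  qed
  \<comment> \<open>One edge of the class decides; \<open>W_along\<close> recovers the semicubes
    from that edge alone.\<close>
  define c where "c E = (SOME i. \<exists>u v. along i u v \<and> cls u v = E)" for E
  have c: "\<exists>u v. along (c E) u v \<and> cls u v = E" if "E \<in> Theta_classes G" for E
  proof -
    have "\<exists>i u v. along i u v \<and> cls u v = E"
      using that along_exists unfolding Theta_classes_eq by blast
    then show ?thesis unfolding c_def by (rule someI_ex)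
  qed
  have "c E \<noteq> c F" if EF: "E \<in> Theta_classes G" "F \<in> Theta_classes G" "cross G E F" for E F
  proof
    assume eq: "c E = c F"
    define i where "i = c E"
    obtain u v where uv: "along i u v" "cls u v = E" using c[OF EF(1)] i_def by blast
    obtain x y where xy: "along i x y" "cls x y = F" using c[OF EF(2)] eq i_def by metis
    have arcs: "(u, v) \<in> parcs G" "(x, y) \<in> parcs G" "i < t"
      "(f u ! i, f v ! i) \<in> parcs (Ts ! i)" "(f x ! i, f y ! i) \<in> parcs (Ts ! i)"
      using uv(1) xy(1) by (auto simp: along_def)
    interpret T: tree_graph "Ts ! i" using T arcs(3) .
    have sc: "semicubes G E = {W u v, W v u}" "semicubes G F = {W x y, W y x}"
      using semicubes_cls arcs(1,2) uv(2) xy(2) by auto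
    have meet: "\<exists>z\<in>pverts (Ts ! i). T.d (f a ! i) z < T.d (f b ! i) z \<and> T.d (f a' ! i) z < T.d (f b' ! i) z"
      if ab: "(a, b) \<in> {(u, v), (v, u)}" "(a', b') \<in> {(x, y), (y, x)}" for a b a' b'
    proof -
      have al: "along i a b" "along i a' b'" using ab uv(1) xy(1) along_sym by auto
      have "W a b \<in> semicubes G E" "W a' b' \<in> semicubes G F" using ab by (auto simp: sc)
      then obtain m where m: "m \<in> W a b" "m \<in> W a' b'" using EF(3) unfolding cross_def by blast
      then have "m \<in> pverts G" by (simp add: W_def)
      then show ?thesis
        using m W_along[OF al(1)] W_along[OF al(2)] fi arcs(3) by (intro bexI[of _ "f m ! i"]) (auto simp: D_def)
    qed
    \<comment> \<open>Crossing makes all four pairs of halves meet, so the two tree edges coincide.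
      Then their preimages, and hence \<open>E\<close> and \<open>F\<close>, coincide, but no class
      crosses itself.\<close>
    have "{f u ! i, f v ! i} = {f x ! i, f y ! i}"
    proof (rule T.halves_crossing[OF arcs(4,5)])
      fix a b a' b'
      assume "(a, b) \<in> {(f u ! i, f v ! i), (f v ! i, f u ! i)}" "(a', b') \<in> {(f x ! i, f y ! i), (f y ! i, f x ! i)}"
      then show "\<exists>z\<in>pverts (Ts ! i). T.d a z < T.d b z \<and> T.d a' z < T.d b' z"
        using meet[of u v x y] meet[of u v y x] meet[of v u x y] meet[of v u y x] by auto
    qed
    then consider "f u ! i = f x ! i" "f v ! i = f y ! i" | "f u ! i = f y ! i" "f v ! i = f x ! i"
      by (auto simp: doubleton_eq_iff)
    then have "W u v = W x y \<or> W u v = W y x"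
    proof cases
      case 1
      have "a \<in> W u v \<longleftrightarrow> a \<in> W x y" if "a \<in> pverts G" for a
        using W_along[OF uv(1) that] W_along[OF xy(1) that] 1 by (simp add: D_def)
      then show ?thesis by (auto simp: W_def)
    next
      case 2
      have "a \<in> W u v \<longleftrightarrow> a \<in> W y x" if "a \<in> pverts G" for a
        using W_along[OF uv(1) that] W_along[OF along_sym[OF xy(1)] that] 2 by (simp add: D_def)
      then show ?thesis by (auto simp: W_def)
    qed
    then have "semicubes G E = semicubes G F"
    proof
      assume eq: "W u v = W x y"
      then have "W v u = W y x" using W_compl[OF arcs(1)] W_compl[OF arcs(2)] by simp
      then show ?thesis unfolding sc eq by simp
    next
      assume eq: "W u v = W y x"
      then have "W v u = W x y"
        using W_compl[OF arcs(1)] W_compl[OF arcs_symmetric[OF arcs(2)]] by simp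
      then show ?thesis unfolding sc eq by (simp add: insert_commute)
    qed
    then have "E = F" using semicubes_inj EF(1,2) by blast
    then show False using cross_irrefl EF by blast
  qed
  moreover have "c E < t" if "E \<in> Theta_classes G" for E
    using c[OF that] by (auto simp: along_def)
  ultimately have "proper_colouring (crossing_graph G) t c"
    by (auto simp: proper_colouring_def crossing_graph_def)
  then show thesis using that t_def by blast
qed

lemma tdim_eq_chromatic_number:
  assumes "card (pverts G) \<noteq> 1"
  shows "tdim G = chromatic_number (crossing_graph G)"
proof -
  have "(\<exists>(Ts :: nat pair_pre_digraph list) f. length Ts = t \<and> (\<forall>T\<in>set Ts. undirected_tree T) \<and>
      isometric_embedding f G (cartesian_product Ts)) \<longleftrightarrow> (\<exists>c. proper_colouring (crossing_graph G) t c)" for t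
    using colouring_imp_embedding embedding_imp_colouring by metis
  then show ?thesis using assms by (simp add: tdim_def chromatic_number_def)
qed

lemma chromatic_number_one_vertex:
  assumes "card (pverts G) = 1"
  shows "chromatic_number (crossing_graph G) = 0"
proof -
  obtain v where v: "pverts G = {v}" using assms by (auto simp: card_1_singleton_iff)
  have "(a, b) \<notin> parcs G" for a b
    using wellformed'[of a b] no_loops'[of a b] v by auto
  then have "Theta_classes G = {}" by (auto simp: Theta_classes_eq)
  then have "proper_colouring (crossing_graph G) 0 c" for c
    by (simp add: proper_colouring_def crossing_graph_def)
  then show ?thesis unfolding chromatic_number_def by (intro Least_equality) auto
qed

text \<open>The least value is attained because some colouring exists: there are finitely many
  classes and none crosses itself, so an injective numbering is proper.\<close>

lemma chromatic_number_colouring: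
  obtains c where "proper_colouring (crossing_graph G) (chromatic_number (crossing_graph G)) c"
proof -
  obtain c and n :: nat where c: "c ` Theta_classes G = {i. i < n}" "inj_on c (Theta_classes G)"
    using finite_imp_inj_to_nat_seg[OF finite_Theta_classes] by blast
  have "c E < n" if "E \<in> Theta_classes G" for E using c(1) that by blast
  moreover have "c E \<noteq> c F" if "E \<in> Theta_classes G" "F \<in> Theta_classes G" "cross G E F" for E F
    using that c(2) cross_irrefl by (metis inj_onD)
  ultimately have "proper_colouring (crossing_graph G) n c"
    by (auto simp: proper_colouring_def crossing_graph_def)
  then have "\<exists>k c. proper_colouring (crossing_graph G) k c" by blast
  then have "\<exists>c. proper_colouring (crossing_graph G) (chromatic_number (crossing_graph G)) c"
    unfolding chromatic_number_def by (rule LeastI_ex)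
  with that show thesis by blast
qed

end

lemma ceiling_half: "\<lceil>(real n + 1) / 2\<rceil> = int ((n + 2) div 2)"
proof (cases "even n")
  case True
  then obtain m where "n = 2 * m" by (elim evenE)
  then show ?thesis by (simp add: ceiling_eq_iff)
next
  case False
  then obtain m where "n = 2 * m + 1" by (elim oddE)
  then show ?thesis by (simp add: ceiling_eq_iff)
qed

theorem theorem3p5:
  fixes M :: "'a pair_pre_digraph"
  assumes "median_graph M"
  shows "int (cop_number M) \<le> \<lceil>(real (tdim M) + 1) / 2\<rceil> \<and>
    \<lceil>(real (tdim M) + 1) / 2\<rceil> = \<lceil>(real (chromatic_number (crossing_graph M)) + 1) / 2\<rceil>"
proof -
  interpret median M using median_graph_median[OF assms] .
  define t where "t = chromatic_number (crossing_graph M)"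
  obtain c where "proper_colouring (crossing_graph M) t c"
    using chromatic_number_colouring unfolding t_def by blast
  \<comment> \<open>The least \<open>k\<close> with \<open>t \<le> 2 * k - 1\<close> and
    \<open>0 < k\<close>.\<close>
  then have "cops_win M ((t + 2) div 2)" by (rule cops_win_colouring) linarith+
  then have "cop_number M \<le> (t + 2) div 2" unfolding cop_number_def by (rule Least_le)
  \<comment> \<open>For the one-vertex graph the two invariants differ, being 1 and 0, but rounding
    gives 1 in both cases.\<close>
  moreover have "(tdim M + 2) div 2 = (t + 2) div 2"
  proof (cases "card (pverts M) = 1")
    case True
    then have "tdim M = 1" "t = 0" using chromatic_number_one_vertex by (auto simp: tdim_def t_def)
    then show ?thesis by simp
  next
    case False
    then show ?thesis using tdim_eq_chromatic_number t_def by simp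
  qed
  ultimately show ?thesis unfolding ceiling_half t_def by simp
qed

end
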